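(* For each integer $n \ge 1$, let $\theta(n)$ denote the number of $3$AP-free permutations of $\{1,\dots,n\}$. Then the limit $\lim_{n\to\infty}\theta(n)^{1/n}$ does not exist.
   Context: A permutation $(\pi_1,\dots,\pi_n)$ of $\{1,\dots,n\}$ is said to be $3$AP-free if there are no indices $i<j<k$ in $\{1,\dots,n\}$ satisfying $\pi_i+\pi_k=2\pi_j$. *)

theory Defs
  imports Complex_Main "HOL-Combinatorics.Permutations"
begin

definition three_ap_free :: "nat \<Rightarrow> (nat \<Rightarrow> nat) \<Rightarrow> bool" where
  "three_ap_free n p \<longleftrightarrow>
     \<not> (\<exists>i\<in>{1..n}. \<exists>j\<in>{1..n}. \<exists>k\<in>{1..n}. i < j \<and> j < k \<and> p i + p k = 2 * p j)"

(* permutes makes p the identity outside {1..n}, so each permutation is counted exactly once *)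
definition theta :: "nat \<Rightarrow> nat" where
  "theta n = card {p. p permutes {1..n} \<and> three_ap_free n p}"

end

theory Submission
  imports Defs
begin

text \<open>
  Write the values as \<open>0, \<dots>, N - 1\<close>, so that \<open>\<theta>(N)\<close> counts the orders on
  \<open>{0, \<dots>, N - 1}\<close> in which no progression \<open>a, a + d, a + 2 d\<close> has its middle term placed between its
  outer terms. Along any progression the comparisons of consecutive terms therefore alternate. Along
  \<open>0, 1, 2, \<dots>\<close> this means that one parity class leads: each of its members precedes its neighbours.
  The key lemma \<open>leading_class_precedes_middle\<close> extends this from difference \<open>1\<close> to every odd
  difference \<open>d\<close>, for pairs \<open>a, a + d\<close> that belong to a progression of three terms. So an order is
  the leading class followed by the other one, except for inversions between two numbers that
  form no three-term progression as neighbours; such pairs lie far apart, in opposite halves.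

  Hence an order on \<open>2 n\<close> numbers is a pair of orders on \<open>n\<close> numbers, glued in essentially one of a
  bounded number of ways that only depend on the end of the first and the beginning of the second.
  So \<open>\<theta>(2 n)\<close> is \<open>\<theta>(n)\<^sup>2\<close> up to bounded factors, and the values of \<open>\<theta>(n)\<close> to the power \<open>1 / n\<close> along
  \<open>n = 2\<^sup>k m\<close> settle near a number that depends on the starting point \<open>m\<close>. It suffices to separate
  \<open>m = 16\<close> from \<open>m = 10\<close>.

  \<^item> Gluing without inversions gives \<open>\<theta>(2 n) \<ge> 2 \<theta>(n)\<^sup>2\<close>, and gluing with at most one inversion,
    applied to the known orders for \<open>n = 8\<close>, gives \<open>\<theta>(16) \<ge> 199872\<close>. So the values
    along \<open>16 \<cdot> 2\<^sup>k\<close> stay above \<open>399744\<close> to the power \<open>1 / 16\<close>, asymptotically.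

  \<^item> For \<open>n = 10 \<cdot> 2\<^sup>k\<close> cut the range into ten blocks and record, for both ends of an order, the
    block of the end element and the length of the run of elements at that end in the same half of
    the range. These types are inherited when orders are glued, and they bound the number of
    gluings. The number of orders with given types at both ends is thus dominated by a
    matrix recursion \<open>Q \<mapsto> 2 Q K Q\<close>, so that \<open>2 K Q\<close> is at most squared when \<open>n\<close> doubles. An
    approximate dominant eigenvector for \<open>n = 10\<close> certifies the spectral bound \<open>3100\<close>, and the
    values along \<open>10 \<cdot> 2\<^sup>k\<close> stay below \<open>3100\<close> to the power \<open>1 / 10\<close>, asymptotically.

  Since \<open>3100\<^sup>8 < 399744\<^sup>5\<close>, the two subsequences have no common limit.
\<close>

section \<open>Precedence in lists and progression-free orders\<close>

fun prec :: "'a list \<Rightarrow> 'a \<Rightarrow> 'a \<Rightarrow> bool" where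
  "prec [] x y \<longleftrightarrow> False"
| "prec (a # xs) x y \<longleftrightarrow> x = a \<and> y \<in> set xs \<or> prec xs x y"

lemma prec_in_set: "prec xs x y \<Longrightarrow> x \<in> set xs \<and> y \<in> set xs"
  by (induction xs) auto

lemma prec_append:
  "prec (xs @ ys) x y \<longleftrightarrow> prec xs x y \<or> prec ys x y \<or> x \<in> set xs \<and> y \<in> set ys"
  by (induction xs) auto

lemma prec_rev: "prec (rev xs) x y \<longleftrightarrow> prec xs y x"
  by (induction xs) (auto simp: prec_append)

lemma prec_filter: "prec (filter P xs) x y \<longleftrightarrow> P x \<and> P y \<and> prec xs x y"
  by (induction xs) auto

lemma prec_map: "inj f \<Longrightarrow> prec (map f xs) (f x) (f y) \<longleftrightarrow> prec xs x y"
  by (induction xs) (auto simp: inj_eq)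

lemma prec_mapE:
  assumes "prec (map f xs) u v"
  obtains x y where "u = f x" "v = f y" "prec xs x y"
  using assms by (induction xs) auto

lemma prec_total: "x \<in> set xs \<Longrightarrow> y \<in> set xs \<Longrightarrow> x \<noteq> y \<Longrightarrow> prec xs x y \<or> prec xs y x"
  by (induction xs) auto

lemma prec_asym: "distinct xs \<Longrightarrow> prec xs x y \<Longrightarrow> \<not> prec xs y x"
  by (induction xs) (auto dest: prec_in_set)

lemma prec_trans: "distinct xs \<Longrightarrow> prec xs x y \<Longrightarrow> prec xs y z \<Longrightarrow> prec xs x z"
  by (induction xs) (auto dest: prec_in_set)

lemma prec_nth:
  "prec xs x y \<longleftrightarrow> (\<exists>i j. i < j \<and> j < length xs \<and> xs ! i = x \<and> xs ! j = y)"
proof (induction xs)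
  case (Cons a xs)
  show ?case (is "?L \<longleftrightarrow> ?R")
  proof
    assume ?L
    then consider "x = a" "y \<in> set xs" | "prec xs x y" by auto
    then show ?R
    proof cases
      case 1
      then obtain j where "j < length xs" "xs ! j = y" by (auto simp: in_set_conv_nth)
      with 1 show ?thesis by (intro exI[of _ 0] exI[of _ "Suc j"]) auto
    next
      case 2
      then obtain i j where "i < j" "j < length xs" "xs ! i = x" "xs ! j = y"
        using Cons.IH by blast
      then show ?thesis by (intro exI[of _ "Suc i"] exI[of _ "Suc j"]) auto
    qed
  next
    assume ?R
    then obtain i j where ij: "i < j" "j < Suc (length xs)" "(a # xs) ! i = x" "(a # xs) ! j = y"
      by auto
    then obtain j' where j': "j = Suc j'" by (cases j) auto
    show ?L
    proof (cases i)
      case 0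
      with ij j' show ?thesis by auto
    next
      case (Suc i')
      with ij j' have "\<exists>i j. i < j \<and> j < length xs \<and> xs ! i = x \<and> xs ! j = y"
        by (intro exI[of _ i'] exI[of _ j']) auto
      then show ?thesis using Cons.IH by simp
    qed
  qed
qed auto

definition ap_free :: "nat list \<Rightarrow> bool" where
  "ap_free xs \<longleftrightarrow> (\<forall>x y z. prec xs x y \<longrightarrow> prec xs y z \<longrightarrow> x + z \<noteq> 2 * y)"

text \<open>
  Starting the values at \<open>0\<close> makes the two parity classes the images of \<open>x \<mapsto> 2 x\<close> and
  \<open>x \<mapsto> 2 x + 1\<close>, and turns the block of a value into a quotient that is unaffected by
  this doubling.
\<close>

definition orders :: "nat \<Rightarrow> nat list set" where
  "orders n = {xs. distinct xs \<and> set xs = {..<n} \<and> ap_free xs}"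

lemma ordersD:
  assumes "X \<in> orders n"
  shows "distinct X" "set X = {..<n}" "ap_free X" "length X = n"
  using assms distinct_card[of X] by (auto simp: orders_def)

lemma finite_orders: "finite (orders n)"
proof (rule finite_subset)
  show "orders n \<subseteq> {xs. set xs \<subseteq> {..<n} \<and> length xs = n}"
    using ordersD by auto
qed (simp add: finite_lists_length_eq)

lemma rev_orders: "rev X \<in> orders n \<longleftrightarrow> X \<in> orders n"
proof -
  have "ap_free (rev X) \<longleftrightarrow> ap_free X" for X
    unfolding ap_free_def prec_rev by (metis add.commute)
  then show ?thesis by (simp add: orders_def)
qed

text \<open>
  The definition of \<open>ap_free\<close> through \<open>prec\<close> survives filtering, reversal and gluing; the
  description by positions serves to compare it with the one for permutations.
\<close>

lemma ap_free_nth: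
  assumes "distinct X"
  shows "ap_free X \<longleftrightarrow> (\<forall>i j k. i < j \<longrightarrow> j < k \<longrightarrow> k < length X \<longrightarrow> X ! i + X ! k \<noteq> 2 * X ! j)"
    (is "_ \<longleftrightarrow> ?R")
proof
  assume L: "ap_free X"
  show ?R
  proof (intro allI impI)
    fix i j k assume "i < j" "j < k" "k < length X"
    then have "prec X (X ! i) (X ! j)" "prec X (X ! j) (X ! k)" unfolding prec_nth by force+
    then show "X ! i + X ! k \<noteq> 2 * X ! j" using L unfolding ap_free_def by blast
  qed
next
  assume R: ?R
  have "x + z \<noteq> 2 * y" if "prec X x y" "prec X y z" for x y z
  proof -
    obtain i j where ij: "i < j" "j < length X" "X ! i = x" "X ! j = y"
      using \<open>prec X x y\<close> unfolding prec_nth by blast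
    obtain j' k where jk: "j' < k" "k < length X" "X ! j' = y" "X ! k = z"
      using \<open>prec X y z\<close> unfolding prec_nth by blast
    have "j' = j" using ij jk assms nth_eq_iff_index_eq[of X j' j] by simp
    then show ?thesis using R[rule_format, of i j k] ij jk by simp
  qed
  then show "ap_free X" unfolding ap_free_def by blast
qed

lemma theta_eq_card_orders: "theta n = card (orders n)"
proof -
  define word where "word = (\<lambda>p :: nat \<Rightarrow> nat. map (\<lambda>i. p (Suc i) - 1) [0..<n])"
  have ap: "ap_free (word p) \<longleftrightarrow> three_ap_free n p" and dist: "distinct (word p)" and set: "set (word p) = {..<n}"
    if p: "p permutes {1..n}" for p
  proof -
    have pos: "1 \<le> p (Suc i) \<and> p (Suc i) \<le> n" if "i < n" for i
      using permutes_in_image[OF p, of "Suc i"] that by simp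
    have inj: "inj_on (\<lambda>i. p (Suc i) - 1) {..<n}"
    proof (rule inj_onI)
      fix i j assume "i \<in> {..<n}" "j \<in> {..<n}" and eq: "p (Suc i) - 1 = p (Suc j) - 1"
      then have "i < n" "j < n" by auto
      then have "p (Suc i) = p (Suc j)" using pos[of i] pos[of j] eq by linarith
      then show "i = j" using permutes_inj[OF p] by (simp add: inj_eq)
    qed
    then show dist: "distinct (word p)" by (simp add: word_def distinct_map atLeast0LessThan)
    have "(\<lambda>i. p (Suc i) - 1) ` {..<n} \<subseteq> {..<n}" using pos by fastforce
    then show "set (word p) = {..<n}"
      using endo_inj_surj[OF _ _ inj] by (simp add: word_def atLeast0LessThan)
    have "ap_free (word p) \<longleftrightarrow>
        (\<forall>i j k. i < j \<longrightarrow> j < k \<longrightarrow> k < n \<longrightarrow> p (Suc i) + p (Suc k) \<noteq> 2 * p (Suc j))"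
    proof -
      have "word p ! i + word p ! k = 2 * word p ! j \<longleftrightarrow> p (Suc i) + p (Suc k) = 2 * p (Suc j)"
        if "i < j" "j < k" "k < n" for i j k
        using pos[of i] pos[of j] pos[of k] that by (simp add: word_def) linarith
      then show ?thesis unfolding ap_free_nth[OF dist] by (auto simp: word_def)
    qed
    also have "\<dots> \<longleftrightarrow> three_ap_free n p"
    proof
      assume *: "\<forall>i j k. i < j \<longrightarrow> j < k \<longrightarrow> k < n \<longrightarrow> p (Suc i) + p (Suc k) \<noteq> 2 * p (Suc j)"
      have "p i + p k \<noteq> 2 * p j" if "i \<in> {1..n}" "j \<in> {1..n}" "k \<in> {1..n}" "i < j" "j < k" for i j k
        using *[rule_format, of "i - 1" "j - 1" "k - 1"] that by simp
      then show "three_ap_free n p" unfolding three_ap_free_def by blast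
    next
      assume *: "three_ap_free n p"
      show "\<forall>i j k. i < j \<longrightarrow> j < k \<longrightarrow> k < n \<longrightarrow> p (Suc i) + p (Suc k) \<noteq> 2 * p (Suc j)"
      proof (intro allI impI)
        fix i j k assume "i < j" "j < k" "k < n"
        then have "Suc i \<in> {1..n}" "Suc j \<in> {1..n}" "Suc k \<in> {1..n}" "Suc i < Suc j" "Suc j < Suc k"
          by auto
        then show "p (Suc i) + p (Suc k) \<noteq> 2 * p (Suc j)"
          using * unfolding three_ap_free_def by blast
      qed
    qed
    finally show "ap_free (word p) \<longleftrightarrow> three_ap_free n p" .
  qed
  have "bij_betw word {p. p permutes {1..n} \<and> three_ap_free n p} (orders n)"
  proof (rule bij_betw_imageI)
    show "inj_on word {p. p permutes {1..n} \<and> three_ap_free n p}"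
    proof (rule inj_onI)
      fix p q assume "p \<in> {p. p permutes {1..n} \<and> three_ap_free n p}" "q \<in> {p. p permutes {1..n} \<and> three_ap_free n p}"
      then have p: "p permutes {1..n}" and q: "q permutes {1..n}" by auto
      assume eq: "word p = word q"
      show "p = q"
      proof
        fix x
        show "p x = q x"
        proof (cases "x \<in> {1..n}")
          case True
          then have "x - 1 < n" "Suc (x - 1) = x" by auto
          then have "p x - 1 = q x - 1"
            using arg_cong[OF eq, of "\<lambda>w. w ! (x - 1)"] by (simp add: word_def)
          moreover have "1 \<le> p x" "1 \<le> q x"
            using permutes_in_image[OF p, of x] permutes_in_image[OF q, of x] True by auto
          ultimately show ?thesis by simp
        next
          case False
          then show ?thesis using permutes_not_in[OF p] permutes_not_in[OF q] by simp
        qed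
      qed
    qed
    show "word ` {p. p permutes {1..n} \<and> three_ap_free n p} = orders n"
    proof (intro equalityI subsetI)
      fix X assume "X \<in> word ` {p. p permutes {1..n} \<and> three_ap_free n p}"
      then show "X \<in> orders n" using ap dist set by (auto simp: orders_def)
    next
      fix X assume X: "X \<in> orders n"
      note D = ordersD[OF X]
      define p where "p = (\<lambda>x. if x \<in> {1..n} then Suc (X ! (x - 1)) else x)"
      have lt: "X ! i < n" if "i < n" for i using D(2,4) nth_mem[of i X] that by auto
      have inj: "inj_on p {1..n}"
      proof (rule inj_onI)
        fix x y assume xy: "x \<in> {1..n}" "y \<in> {1..n}" "p x = p y"
        then have "X ! (x - 1) = X ! (y - 1)" by (simp add: p_def)
        moreover have "x - 1 < length X" "y - 1 < length X" using xy D(4) by auto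
        ultimately have "x - 1 = y - 1" using nth_eq_iff_index_eq[OF D(1)] by blast
        then show "x = y" using xy by auto
      qed
      have "p ` {1..n} \<subseteq> {1..n}"
      proof (rule image_subsetI)
        fix x assume "x \<in> {1..n}"
        then have "x - 1 < n" by auto
        from lt[OF this] \<open>x \<in> {1..n}\<close> show "p x \<in> {1..n}" by (simp add: p_def)
      qed
      then have "bij_betw p {1..n} {1..n}"
        using endo_inj_surj[OF _ _ inj] inj by (simp add: bij_betw_def)
      then have perm: "p permutes {1..n}" by (rule bij_imp_permutes) (auto simp: p_def)
      have w: "word p = X"
        by (rule nth_equalityI) (simp_all add: word_def p_def D(4))
      then have "three_ap_free n p" using ap[OF perm] D(3) by simp
      then show "X \<in> word ` {p. p permutes {1..n} \<and> three_ap_free n p}" using perm w by force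
    qed
  qed
  then show ?thesis unfolding theta_def by (rule bij_betw_same_card)
qed

section \<open>Inversions between the two parity classes\<close>

lemma middle_not_between:
  assumes "X \<in> orders N" "0 < d" "a + 2 * d < N"
  shows "prec X a (a + d) \<longleftrightarrow> prec X (a + 2 * d) (a + d)"
proof -
  note X = ordersD[OF assms(1)]
  have "\<not> (prec X a (a + d) \<and> prec X (a + d) (a + 2 * d))"
    using X(3)[unfolded ap_free_def, rule_format, of a "a + d" "a + 2 * d"] by auto
  moreover have "\<not> (prec X (a + 2 * d) (a + d) \<and> prec X (a + d) a)"
    using X(3)[unfolded ap_free_def, rule_format, of "a + 2 * d" "a + d" a] by auto
  moreover have "prec X a (a + d) \<or> prec X (a + d) a"
    "prec X (a + 2 * d) (a + d) \<or> prec X (a + d) (a + 2 * d)"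
    using assms X(2) by (simp_all add: prec_total)
  ultimately show ?thesis using prec_asym[OF X(1)] by blast
qed

lemma prec_flip:
  assumes "X \<in> orders N" "x < N" "y < N" "x \<noteq> y"
  shows "prec X x y \<longleftrightarrow> \<not> prec X y x"
  using ordersD[OF assms(1)] prec_total[of x X y] prec_asym[of X] assms by blast

text \<open>
  By \<open>middle_not_between\<close> each interior term of a progression precedes both of its neighbours or
  follows both.
\<close>

lemma progression_alternates:
  assumes X: "X \<in> orders N" and s: "0 < s" and N: "a + Suc i * s < N"
  shows "prec X (a + i * s) (a + Suc i * s) \<longleftrightarrow> (even i \<longleftrightarrow> prec X a (a + s))"
  using N
proof (induction i)
  case (Suc i)
  let ?u = "a + i * s"
  have eqs: "a + Suc i * s = ?u + s" "a + Suc (Suc i) * s = ?u + 2 * s"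
    by (simp_all add: algebra_simps)
  have N: "?u + 2 * s < N" using Suc.prems eqs by simp
  have "prec X (?u + s) (?u + 2 * s) \<longleftrightarrow> \<not> prec X (?u + 2 * s) (?u + s)"
    by (rule prec_flip[OF X]) (use N s in auto)
  moreover have "prec X (?u + 2 * s) (?u + s) \<longleftrightarrow> prec X ?u (?u + s)"
    using middle_not_between[OF X s N] by simp
  moreover have "prec X ?u (?u + s) \<longleftrightarrow> (even i \<longleftrightarrow> prec X a (a + s))"
    using Suc.IH Suc.prems unfolding eqs(1) by simp
  ultimately show ?case unfolding eqs even_Suc by blast
qed simp

definition leads :: "nat \<Rightarrow> nat list \<Rightarrow> nat \<Rightarrow> bool" where
  "leads \<delta> X N \<longleftrightarrow> (\<forall>i<N. \<forall>j<N. (j = i + 1 \<or> i = j + 1) \<longrightarrow> i mod 2 = \<delta> \<longrightarrow> prec X i j)"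

lemma leads_exists:
  assumes X: "X \<in> orders N"
  shows "leads (if prec X 0 1 then 0 else 1) X N"
proof -
  have alt: "prec X i (i + 1) \<longleftrightarrow> (even i \<longleftrightarrow> prec X 0 1)" if "i + 1 < N" for i
    using progression_alternates[OF X, of 1 0 i] that by simp
  have up: "prec X i (i + 1)" if "i + 1 < N" "i mod 2 = (if prec X 0 1 then 0 else 1)" for i
    using that unfolding alt[OF that(1)] by (cases "prec X 0 1") (simp_all add: even_iff_mod_2_eq_zero)
  have down: "prec X (i + 1) i" if "i + 1 < N" "(i + 1) mod 2 = (if prec X 0 1 then 0 else 1)" for i
  proof -
    have "even i \<longleftrightarrow> \<not> prec X 0 1"
      using that(2) by (cases "prec X 0 1") (simp_all, presburger+)
    then have "\<not> prec X i (i + 1)" unfolding alt[OF that(1)] by blast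
    then show ?thesis using prec_flip[OF X, of i "i + 1"] that(1) by simp
  qed
  show ?thesis unfolding leads_def using up down by metis
qed

lemma leads_rev:
  assumes "X \<in> orders N" "leads \<delta> X N" "\<delta> < 2"
  shows "leads (1 - \<delta>) (rev X) N"
  using assms unfolding leads_def prec_rev by (auto simp: mod2_eq_if split: if_splits)

text \<open>
  Induction on \<open>d\<close> in steps of two. If \<open>a + d\<close> came before \<open>a\<close>, it would also come before
  \<open>a + 2 d\<close>. By induction the inner progression \<open>a + 2, a + d, a + 2 d - 2\<close> has its outer terms
  before \<open>a + d\<close>. Hence \<open>a + 2\<close> precedes \<open>a\<close> and \<open>a + 2 d - 2\<close> precedes \<open>a + 2 d\<close>. But along
  \<open>a, a + 2, \<dots>, a + 2 d\<close> the comparisons alternate, and as \<open>d\<close> is odd the first and the last of them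
  point in the same direction.
\<close>

lemma leading_class_precedes_middle:
  assumes X: "X \<in> orders N" and lead: "leads \<delta> X N"
    and "odd d" "a + 2 * d < N" "a mod 2 = \<delta>"
  shows "prec X a (a + d)"
  using assms(3-)
proof (induction d arbitrary: a rule: less_induct)
  case (less d)
  show ?case
  proof (cases "d = 1")
    case True
    then show ?thesis
      using lead[unfolded leads_def, rule_format, of a "a + 1"] less.prems by simp
  next
    case False
    define e where "e = d - 2"
    have e: "d = e + 2" "odd e"
      using less.prems(1) False unfolding e_def by presburger+
    have N: "a + 2 * e + 4 < N" using less.prems e by simp
    \<comment> \<open>The two inner neighbours \<open>a + 2\<close> and \<open>a + 2 d - 2\<close> come before the middle term \<open>a + d\<close>.\<close>
    have in1: "prec X (a + 2) (a + d)"
      using less.IH[of e "a + 2"] N e less.prems by (simp add: algebra_simps)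
    then have in2: "prec X (a + 2 * e + 2) (a + d)"
      using middle_not_between[OF X, of e "a + 2"] N e by (simp add: algebra_simps odd_pos)
    show ?thesis
    proof (rule ccontr)
      assume neg: "\<not> prec X a (a + d)"
      have d0: "0 < d" using e by simp
      have out1: "prec X (a + d) a"
        using neg prec_flip[OF X, of a "a + d"] less.prems d0 by auto
      have out2: "prec X (a + d) (a + 2 * d)"
        using neg middle_not_between[OF X d0 less.prems(2)] prec_flip[OF X, of "a + d" "a + 2 * d"]
          less.prems d0 by auto
      have 1: "prec X (a + 2) a" using prec_trans[OF ordersD(1)[OF X]] in1 out1 by blast
      have 2: "prec X (a + 2 * e + 2) (a + 2 * e + 4)"
      proof -
        have "a + 2 * d = a + 2 * e + 4" using e by simp
        then show ?thesis using prec_trans[OF ordersD(1)[OF X] in2 out2] by metis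
      qed
      have eqs: "a + (e + 1) * 2 = a + 2 * e + 2" "a + Suc (e + 1) * 2 = a + 2 * e + 4"
        by simp_all
      have "prec X (a + 2 * e + 2) (a + 2 * e + 4) \<longleftrightarrow> (even (e + 1) \<longleftrightarrow> prec X a (a + 2))"
        unfolding eqs[symmetric] by (rule progression_alternates[OF X]) (use N in auto)
      moreover have "\<not> prec X a (a + 2)"
        using 1 prec_asym[OF ordersD(1)[OF X]] by blast
      ultimately show False using 2 e by simp
    qed
  qed
qed

text \<open>
  The case of a progression whose outer terms lie in the other class is the mirror image:
  reversing an order exchanges the roles of the two classes.
\<close>

lemma leading_class_precedes_middle':
  assumes X: "X \<in> orders N" and lead: "leads \<delta> X N" and "\<delta> < 2"
    and d: "odd d" "a + 2 * d < N"
  shows "if a mod 2 = \<delta> then prec X a (a + d) \<and> prec X (a + 2 * d) (a + d)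
         else prec X (a + d) a \<and> prec X (a + d) (a + 2 * d)"
proof -
  have d0: "0 < d" using d by (simp add: odd_pos)
  show ?thesis
  proof (cases "a mod 2 = \<delta>")
    case True
    then show ?thesis
      using leading_class_precedes_middle[OF X lead d True] middle_not_between[OF X d0 d(2)] by simp
  next
    case False
    then have "a mod 2 = 1 - \<delta>" using \<open>\<delta> < 2\<close> by linarith
    then have *: "prec (rev X) a (a + d)"
      using leading_class_precedes_middle[OF _ leads_rev[OF X lead \<open>\<delta> < 2\<close>] d] X rev_orders by blast
    then have "prec (rev X) (a + 2 * d) (a + d)"
      using middle_not_between[of "rev X", OF _ d0 d(2)] X rev_orders by blast
    with * False show ?thesis by (simp add: prec_rev)
  qed
qed

text \<open>
  No third number in \<open>{0, \<dots>, N - 1}\<close> extends \<open>x, y\<close> to a three-term progression on the left or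
  on the right.
\<close>

definition extremal :: "nat \<Rightarrow> nat \<Rightarrow> nat \<Rightarrow> bool" where
  "extremal N x y \<longleftrightarrow> 2 * min x y < max x y \<and> N + min x y \<le> 2 * max x y"

lemma inversion_is_extremal:
  assumes X: "X \<in> orders N" and lead: "leads \<delta> X N" and "\<delta> < 2"
    and x: "x mod 2 = \<delta>" and y: "y mod 2 \<noteq> \<delta>" and inv: "prec X y x"
  shows "extremal N x y"
proof -
  note D = ordersD[OF X]
  have xy: "x < N" "y < N" "x \<noteq> y" using prec_in_set[OF inv] D x y by auto
  have nxy: "\<not> prec X x y" using inv prec_asym[OF D(1)] by blast
  define a b where "a = min x y" and "b = max x y"
  define d where "d = b - a"
  have ab: "b = a + d" "0 < d" "b < N" using xy by (auto simp: a_def b_def d_def)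
  have d: "odd d"
  proof -
    have "odd (x + y)" using x y by presburger
    moreover have "x + y = 2 * a + d" using xy by (auto simp: a_def b_def d_def)
    ultimately show ?thesis by simp
  qed
  have "2 * a < b"
  proof (rule ccontr)
    assume "\<not> 2 * a < b"
    define e where "e = a - d"
    have e: "a = e + d" "b = e + 2 * d" using \<open>\<not> 2 * a < b\<close> ab by (auto simp: e_def)
    have "if e mod 2 = \<delta> then prec X e a \<and> prec X b a else prec X a e \<and> prec X a b"
      using leading_class_precedes_middle'[OF X lead \<open>\<delta> < 2\<close> d, of e] ab(3)
      unfolding e[symmetric] by (simp add: e(1)[symmetric] e(2)[symmetric])
    moreover have "e mod 2 = b mod 2" using e by simp
    ultimately have "if b mod 2 = \<delta> then prec X b a else prec X a b" by (simp split: if_splits)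
    then show False using x y nxy inv unfolding a_def b_def
      by (cases "x \<le> y") (simp_all add: min_def max_def split: if_splits)
  qed
  moreover have "N + a \<le> 2 * b"
  proof (rule ccontr)
    assume "\<not> N + a \<le> 2 * b"
    then have "a + 2 * d < N" using ab by simp
    then have "if a mod 2 = \<delta> then prec X a b else prec X b a"
      using leading_class_precedes_middle'[OF X lead \<open>\<delta> < 2\<close> d, of a] ab(1)
      by (simp split: if_splits)
    then show False using x y nxy inv unfolding a_def b_def
      by (cases "x \<le> y") (simp_all add: min_def max_def split: if_splits)
  qed
  ultimately show ?thesis by (simp add: extremal_def a_def b_def)
qed

section \<open>Gluing two orders\<close>

text \<open>
  Rescaled to consecutive numbers, a parity class of an order on \<open>2 n\<close> elements is an order on \<open>n\<close>
  elements; this is what makes the recursion possible.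
\<close>

definition pick :: "nat \<Rightarrow> nat list \<Rightarrow> nat list" where
  "pick \<delta> X = map (\<lambda>x. x div 2) (filter (\<lambda>x. x mod 2 = \<delta>) X)"

definition spread :: "nat \<Rightarrow> nat list \<Rightarrow> nat list" where
  "spread \<delta> A = map (\<lambda>x. 2 * x + \<delta>) A"

lemma spread_pick: "spread \<delta> (pick \<delta> X) = filter (\<lambda>x. x mod 2 = \<delta>) X"
proof -
  have "2 * (x div 2) + \<delta> = x" if "x mod 2 = \<delta>" for x :: nat
    using that by presburger
  then show ?thesis by (induction X) (auto simp: spread_def pick_def)
qed

lemma pick_spread: "\<delta> < 2 \<Longrightarrow> pick \<delta> (spread \<delta> A) = A"
  by (induction A) (auto simp: spread_def pick_def)

lemma inj_spread: "inj (\<lambda>x::nat. 2 * x + \<delta>)"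
  by (auto simp: inj_def)

lemma ap_free_spread: "ap_free (spread \<delta> A) \<longleftrightarrow> ap_free A"
proof
  assume *: "ap_free (spread \<delta> A)"
  show "ap_free A" unfolding ap_free_def
  proof (intro allI impI)
    fix x y z assume "prec A x y" "prec A y z"
    then have "prec (spread \<delta> A) (2 * x + \<delta>) (2 * y + \<delta>)" "prec (spread \<delta> A) (2 * y + \<delta>) (2 * z + \<delta>)"
      unfolding spread_def by (simp_all add: prec_map[OF inj_spread])
    then have "(2 * x + \<delta>) + (2 * z + \<delta>) \<noteq> 2 * (2 * y + \<delta>)"
      using * unfolding ap_free_def by blast
    then show "x + z \<noteq> 2 * y" by simp
  qed
next
  assume *: "ap_free A"
  show "ap_free (spread \<delta> A)" unfolding ap_free_def
  proof (intro allI impI)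
    fix x y z assume xy: "prec (spread \<delta> A) x y" and yz: "prec (spread \<delta> A) y z"
    obtain x' y' where 1: "x = 2 * x' + \<delta>" "y = 2 * y' + \<delta>" "prec A x' y'"
      using xy unfolding spread_def by (elim prec_mapE) auto
    obtain y'' z' where 2: "y = 2 * y'' + \<delta>" "z = 2 * z' + \<delta>" "prec A y'' z'"
      using yz unfolding spread_def by (elim prec_mapE) auto
    have "y'' = y'" using 1 2 by simp
    then have "x' + z' \<noteq> 2 * y'" using 1 2 * unfolding ap_free_def by blast
    then show "x + z \<noteq> 2 * y" using 1 2 by simp
  qed
qed

lemma ap_free_filter: "ap_free X \<Longrightarrow> ap_free (filter P X)"
  unfolding ap_free_def prec_filter by blast

lemma pick_orders:
  assumes X: "X \<in> orders (2 * n)" and "\<delta> < 2"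
  shows "pick \<delta> X \<in> orders n"
proof -
  note D = ordersD[OF X]
  have "ap_free (pick \<delta> X)"
    using ap_free_filter[OF D(3)] ap_free_spread[of \<delta> "pick \<delta> X"] unfolding spread_pick by blast
  moreover have "distinct (pick \<delta> X)"
  proof -
    have "distinct (spread \<delta> (pick \<delta> X))" unfolding spread_pick using D(1) by simp
    then show ?thesis unfolding spread_def distinct_map by blast
  qed
  moreover have "x \<in> set (pick \<delta> X) \<longleftrightarrow> x < n" for x
  proof -
    have "x \<in> set (pick \<delta> X) \<longleftrightarrow> 2 * x + \<delta> \<in> set (spread \<delta> (pick \<delta> X))"
      unfolding spread_def by (simp add: image_iff)
    also have "\<dots> \<longleftrightarrow> (2 * x + \<delta>) mod 2 = \<delta> \<and> 2 * x + \<delta> < 2 * n"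
      unfolding spread_pick using D(2) by simp blast
    also have "\<dots> \<longleftrightarrow> x < n"
    proof -
      have "(2 * x + \<delta>) mod 2 = \<delta>" using \<open>\<delta> < 2\<close> by simp
      moreover have "2 * x + \<delta> < 2 * n \<longleftrightarrow> x < n" using \<open>\<delta> < 2\<close> by linarith
      ultimately show ?thesis by blast
    qed
    finally show ?thesis .
  qed
  then have "set (pick \<delta> X) = {..<n}" by blast
  ultimately show ?thesis by (simp add: orders_def)
qed

lemma filter_append_front:
  assumes "distinct X" "filter P X = A1 @ A2"
    and "\<And>x y. \<not> P y \<Longrightarrow> prec X y x \<Longrightarrow> x \<notin> set A1"
  shows "\<exists>Y. X = A1 @ Y"
  using assms
proof (induction A1 arbitrary: X)
  case (Cons a A1)
  have "a \<in> set X" "P a"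
    using arg_cong[OF Cons.prems(2), of set] by (simp_all add: set_eq_iff) blast+
  then obtain h X' where X: "X = h # X'" by (cases X) auto
  have "P h"
  proof (rule ccontr)
    assume "\<not> P h"
    then have "prec X h a" using \<open>a \<in> set X\<close> \<open>P a\<close> X by auto
    then show False using Cons.prems(3)[OF \<open>\<not> P h\<close>, of a] by simp
  qed
  then have "h = a" "filter P X' = A1 @ A2" using Cons.prems(2) X by auto
  moreover have "\<exists>Y. X' = A1 @ Y"
    using Cons.prems X calculation(2) by (intro Cons.IH) auto
  ultimately show ?case using X by auto
qed simp

text \<open>
  With \<open>P\<close> as the leading class this bounds the number of orders with given parity classes by the
  number of interleavings of the parts \<open>A2\<close> and \<open>B1\<close> that inversions can reach.
\<close>

lemma merge_with_local_inversions:
  assumes "distinct X" "filter P X = A1 @ A2" "filter (\<lambda>x. \<not> P x) X = B1 @ B2"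
    and front: "\<And>x y. \<not> P y \<Longrightarrow> P x \<Longrightarrow> prec X y x \<Longrightarrow> x \<notin> set A1"
    and rear: "\<And>x y. \<not> P y \<Longrightarrow> P x \<Longrightarrow> prec X y x \<Longrightarrow> y \<notin> set B2"
  shows "\<exists>Z. X = A1 @ Z @ B2 \<and> Z \<in> shuffles A2 B1"
proof -
  have PA: "P x" if "x \<in> set A1" for x
    using arg_cong[OF assms(2), of set] that by auto
  have PB: "\<not> P x" if "x \<in> set B2" for x
    using arg_cong[OF assms(3), of set] that by auto
  obtain Y where Y: "X = A1 @ Y"
    using filter_append_front[OF assms(1,2)] front PA by blast
  have fY: "filter P Y = A2" "filter (\<lambda>x. \<not> P x) Y = B1 @ B2"
    using assms(2,3) PA unfolding Y by (auto simp: filter_empty_conv)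
  have "\<exists>V. rev Y = rev B2 @ V"
  proof (rule filter_append_front[where P = "\<lambda>x. \<not> P x" and ?A2.0 = "rev B1"])
    show "distinct (rev Y)" using assms(1) Y by simp
    show "filter (\<lambda>x. \<not> P x) (rev Y) = rev B2 @ rev B1"
      using fY(2) by (simp flip: rev_filter)
    show "y \<notin> set (rev B2)" if "\<not> \<not> P x" "prec (rev Y) x y" for x y
      using rear[of y x] PB[of y] that unfolding Y prec_rev prec_append by auto
  qed
  then obtain V where "rev Y = rev B2 @ V" by blast
  then have V: "Y = rev V @ B2" by (metis rev_append rev_rev_ident)
  define Z where "Z = rev V"
  have Z: "Y = Z @ B2" using V by (simp add: Z_def)
  have "filter P Z = A2" "filter (\<lambda>x. \<not> P x) Z = B1"
    using fY PB unfolding Z by (auto simp: filter_empty_conv)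
  then have "Z \<in> shuffles A2 B1" using partition_in_shuffles[of Z P] by simp
  then show ?thesis using Y Z by blast
qed

section \<open>Counting gluings by the types of the ends\<close>

text \<open>
  Values are divided into ten blocks \<open>0, \<dots>, 9\<close>. The depth is the distance of a block from the
  nearer end of the range, in steps of two blocks.
\<close>

definition depth :: "nat \<Rightarrow> nat" where
  "depth y = min (y div 2) (4 - y div 2)"

text \<open>
  The upper half of the range consists of the blocks from \<open>5\<close> on.
\<close>

definition head_run :: "nat list \<Rightarrow> nat" where
  "head_run c = length (takeWhile (\<lambda>y. (5 \<le> y) = (5 \<le> hd c)) c)"

text \<open>
  The condition on blocks that extremality of a pair of values implies. Such values lie in opposite
  halves. If the smaller is \<open>s N\<close> and the larger is \<open>N - t N\<close>, then \<open>2 s + t < 1\<close> and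
  \<open>s + 2 t \<le> 1\<close>, which excludes the depths \<open>1, 2\<close> and \<open>2, 2\<close>.
\<close>

definition compatible :: "nat \<Rightarrow> nat \<Rightarrow> bool" where
  "compatible y z \<longleftrightarrow> (5 \<le> y) \<noteq> (5 \<le> z) \<and> depth y + depth z \<le> 2"

lemma extremal_compatible:
  assumes m: "0 < m" and b: "b < 20 * m" and ab: "2 * a < b" "20 * m + a \<le> 2 * b"
  shows "compatible (a div (2 * m)) (b div (2 * m))"
proof -
  define p q where "p = a div (2 * m)" and "q = b div (2 * m)"
  have p4: "p \<le> 4" unfolding p_def using m b ab
    by (simp add: less_Suc_eq_le[symmetric] div_less_iff_less_mult)
  have q5: "5 \<le> q" unfolding q_def using m ab by (simp add: less_eq_div_iff_mult_less_eq)
  have q9: "q \<le> 9" unfolding q_def using m b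
    by (simp add: less_Suc_eq_le[symmetric] div_less_iff_less_mult)
  have pa: "p * (2 * m) \<le> a" unfolding p_def by (rule div_times_less_eq_dividend)
  have "p < 2 \<or> 2 \<le> p \<and> 6 \<le> q"
  proof -
    have "6 \<le> q" if "2 \<le> p"
    proof -
      have "2 * (2 * m) \<le> p * (2 * m)" using that by (rule mult_right_mono) simp
      then have "12 * m \<le> b" using pa ab by linarith
      then show ?thesis unfolding q_def using m by (simp add: less_eq_div_iff_mult_less_eq)
    qed
    then show ?thesis by linarith
  qed
  moreover have "8 \<le> q" if "4 \<le> p"
  proof -
    have "4 * (2 * m) \<le> p * (2 * m)" using that by (rule mult_right_mono) simp
    then have "16 * m \<le> b" using pa ab by linarith
    then show ?thesis unfolding q_def using m by (simp add: less_eq_div_iff_mult_less_eq)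
  qed
  ultimately have "depth p + depth q \<le> 2"
  proof -
    assume *: "p < 2 \<or> 2 \<le> p \<and> 6 \<le> q" "4 \<le> p \<Longrightarrow> 8 \<le> q"
    have "p = 0 \<or> p = 1 \<or> p = 2 \<or> p = 3 \<or> p = 4" using p4 by linarith
    moreover have "q = 5 \<or> q = 6 \<or> q = 7 \<or> q = 8 \<or> q = 9" using q5 q9 by linarith
    ultimately show ?thesis using * by (elim disjE) (simp_all add: depth_def)
  qed
  then show ?thesis using p4 q5 unfolding compatible_def p_def q_def by auto
qed

lemma compatible_sym: "compatible y z \<longleftrightarrow> compatible z y"
  by (auto simp: compatible_def)

lemma inversion_compatible:
  assumes m: "0 < m" and X: "X \<in> orders (20 * m)" and lead: "leads \<delta> X (20 * m)" and d: "\<delta> < 2"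
    and x: "x mod 2 = \<delta>" and y: "y mod 2 \<noteq> \<delta>" and inv: "prec X y x"
  shows "compatible (x div 2 div m) (y div 2 div m)"
proof -
  have N: "x < 20 * m" "y < 20 * m" using prec_in_set[OF inv] ordersD(2)[OF X] by auto
  have "compatible (min x y div (2 * m)) (max x y div (2 * m))"
    using inversion_is_extremal[OF X lead d x y inv] N unfolding extremal_def by (intro extremal_compatible[OF m]) auto
  then have "compatible (x div (2 * m)) (y div (2 * m))"
    using compatible_sym by (cases "x \<le> y") (simp_all add: min_def max_def)
  then show ?thesis unfolding div_mult2_eq .
qed

definition coarse :: "nat \<Rightarrow> nat list \<Rightarrow> nat list" where
  "coarse m X = map (\<lambda>x. x div m) X"

text \<open>
  Applied to a list of blocks this describes its beginning; applied to the reversed list, its end.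
\<close>

definition end_type :: "nat list \<Rightarrow> nat \<times> nat" where
  "end_type c = (hd c, head_run c)"

text \<open>
  If the last element of the leading class and the first element of the other class cannot form an
  inversion, then there is none at all. Otherwise all elements of the leading class in inversions
  belong to its final run, those of the other class to its initial run, and the binomial
  coefficient counts the interleavings of these two runs.
\<close>

definition merge_bound :: "nat \<times> nat \<Rightarrow> nat \<times> nat \<Rightarrow> nat" where
  "merge_bound s t = (if compatible (fst s) (fst t) then (snd s + snd t) choose snd s else 1)"

lemma coarse_spread: "\<delta> < 2 \<Longrightarrow> coarse (2 * m) (spread \<delta> A) = coarse m A"
  unfolding coarse_def spread_def div_mult2_eq by simp

lemma length_coarse [simp]: "length (coarse m X) = length X"
  by (simp add: coarse_def)

lemma length_spread [simp]: "length (spread \<delta> X) = length X"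
  by (simp add: spread_def)

lemma head_run_le: "head_run c \<le> length c"
  unfolding head_run_def by (rule length_takeWhile_le)

lemma end_type_take:
  assumes "head_run c < j" "j \<le> length c"
  shows "end_type (take j c @ e) = end_type c"
proof -
  have c: "c \<noteq> []" "0 < j" using assms by auto
  then have hd: "hd (take j c @ e) = hd c" by (cases c; cases j) auto
  define Q where "Q = (\<lambda>y::nat. (5 \<le> y) = (5 \<le> hd c))"
  have run: "head_run c = length (takeWhile Q c)" by (simp add: head_run_def Q_def)
  define b where "b = head_run c"
  have nQ: "\<not> Q (c ! b)"
    using nth_length_takeWhile[of Q c] assms unfolding b_def run by simp
  define r where "r = drop (Suc b) (take j c)"
  have split: "take j c = take b c @ c ! b # r"
    using id_take_nth_drop[of b "take j c"] assms unfolding b_def r_def by (simp add: min_def)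
  have "takeWhile Q c = take b c"
    unfolding b_def run by (rule takeWhile_eq_take)
  then have "\<forall>y\<in>set (take b c). Q y" using set_takeWhileD[of _ Q c] by simp
  then have "takeWhile Q (take j c @ e) = take b c"
    unfolding split using nQ by simp
  then have "head_run (take j c @ e) = b"
    unfolding head_run_def hd Q_def[symmetric] using assms by (simp add: b_def)
  then show ?thesis using hd by (simp add: end_type_def b_def)
qed

text \<open>
  An element after the initial run is preceded, or equalled, by one in the half opposite to the first
  element. An inversion involving the former would put both halves opposite to the same
  element; this confines inversions to the runs.
\<close>

lemma after_head_run:
  assumes "x \<in> set (drop (head_run (map f F)) F)"
  shows "\<exists>w\<in>set F. (w = x \<or> prec F w x) \<and> (5 \<le> f w) \<noteq> (5 \<le> f (hd F))"
proof -
  define b where "b = head_run (map f F)"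
  have b: "b < length F" using assms unfolding b_def by (metis drop_all empty_iff list.set(1) not_le)
  define w where "w = F ! b"
  have split: "F = take b F @ w # drop (Suc b) F" unfolding w_def by (rule id_take_nth_drop[OF b])
  have "drop b F = w # drop (Suc b) F" unfolding w_def using b by (simp add: Cons_nth_drop_Suc)
  then have "x = w \<or> x \<in> set (drop (Suc b) F)" using assms unfolding b_def[symmetric] by simp
  then have "w = x \<or> prec F w x" by (subst split) (auto simp: prec_append)
  moreover have "(5 \<le> f w) \<noteq> (5 \<le> f (hd F))"
  proof -
    have "F \<noteq> []" using b by auto
    then have hd: "hd (map f F) = f (hd F)" by (simp add: hd_map)
    have "b = length (takeWhile (\<lambda>y. (5 \<le> y) = (5 \<le> f (hd F))) (map f F))"
      unfolding b_def head_run_def hd ..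
    then have "\<not> ((5 \<le> map f F ! b) = (5 \<le> f (hd F)))"
      using nth_length_takeWhile[of "\<lambda>y. (5 \<le> y) = (5 \<le> f (hd F))" "map f F"] b by simp
    then show ?thesis using b by (simp add: w_def)
  qed
  moreover have "w \<in> set F" unfolding w_def using b by simp
  ultimately show ?thesis by blast
qed

lemma before_tail_run:
  assumes "x \<in> set (take (length F - head_run (rev (map f F))) F)"
  shows "\<exists>w\<in>set F. (w = x \<or> prec F x w) \<and> (5 \<le> f w) \<noteq> (5 \<le> f (last F))"
proof -
  have "x \<in> set (drop (head_run (map f (rev F))) (rev F))"
    using assms by (simp add: rev_map drop_rev)
  from after_head_run[OF this] show ?thesis by (auto simp: prec_rev hd_rev)
qed

lemma prec_hd: "x \<in> set xs \<Longrightarrow> x = hd xs \<or> prec xs (hd xs) x"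
  by (cases xs) auto

lemma prec_last: "x \<in> set xs \<Longrightarrow> x = last xs \<or> prec xs x (last xs)"
  using prec_hd[of x "rev xs"] by (simp add: prec_rev hd_rev)

text \<open>
  If an element \<open>y\<close> of the other class precedes an element \<open>x\<close> of the leading class, then \<open>y\<close> also
  precedes everything behind \<open>x\<close> in the leading class, and \<open>x\<close> follows everything before \<open>y\<close> in the other
  class. All these pairs are inversions and thus lie in opposite halves, so \<open>x\<close> belongs to
  the final run of its class and \<open>y\<close> to the initial run of its class.
\<close>

lemma merge_shape:
  assumes m: "0 < m" and X: "X \<in> orders (20 * m)" and lead: "leads \<delta> X (20 * m)" and d: "\<delta> < 2"
  defines "A \<equiv> pick \<delta> X" and "B \<equiv> pick (1 - \<delta>) X"
  defines "i \<equiv> 10 * m - head_run (rev (coarse m A))" and "j \<equiv> head_run (coarse m B)"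
  shows "\<exists>Z. X = spread \<delta> (take i A) @ Z @ spread (1 - \<delta>) (drop j B) \<and>
    Z \<in> (if compatible (hd (rev (coarse m A))) (hd (coarse m B))
         then shuffles (spread \<delta> (drop i A)) (spread (1 - \<delta>) (take j B))
         else {spread \<delta> (drop i A) @ spread (1 - \<delta>) (take j B)})"
proof -
  note D = ordersD[OF X]
  define P where "P = (\<lambda>x::nat. x mod 2 = \<delta>)"
  define f where "f = (\<lambda>x. x div 2 div m)"
  define FA where "FA = filter P X"
  define FB where "FB = filter (\<lambda>x. \<not> P x) X"
  have A: "A \<in> orders (10 * m)" and B: "B \<in> orders (10 * m)"
    using pick_orders[of X "10 * m"] X d unfolding A_def B_def by simp_all
  have FA: "FA = spread \<delta> A" unfolding FA_def A_def P_def spread_pick ..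
  have FB: "FB = spread (1 - \<delta>) B"
  proof -
    have "(\<lambda>x. \<not> P x) = (\<lambda>x. x mod 2 = 1 - \<delta>)" unfolding P_def using d by (intro ext) presburger
    then show ?thesis unfolding FB_def B_def spread_pick by simp
  qed
  have cA: "coarse m A = map f FA" and cB: "coarse m B = map f FB"
    using coarse_spread[of \<delta> m A] coarse_spread[of "1 - \<delta>" m B] d
    unfolding FA FB f_def coarse_def div_mult2_eq by simp_all
  have len: "length FA = 10 * m" "length FB = 10 * m" unfolding FA FB using ordersD(4) A B by simp_all
  then have ne: "FA \<noteq> []" "FB \<noteq> []" using m by auto
  have hds: "hd (rev (coarse m A)) = f (last FA)" "hd (coarse m B) = f (hd FB)"
    unfolding cA cB using ne by (simp_all add: hd_map hd_rev last_map)
  have comp: "compatible (f x) (f y)" if "P x" "\<not> P y" "prec X y x" for x y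
    using inversion_compatible[OF m X lead d] that unfolding P_def f_def by blast
  have trans: "prec X x z" if "prec X x y" "prec X y z" for x y z
    using prec_trans[OF D(1)] that by blast
  have last: "P (last FA)" "x = last FA \<or> prec X x (last FA)" if "P x" "x \<in> set X" for x
    using prec_last[of x FA] last_in_set[OF ne(1)] that unfolding FA_def prec_filter by auto
  have first: "\<not> P (hd FB)" "y = hd FB \<or> prec X (hd FB) y" if "\<not> P y" "y \<in> set X" for y
    using prec_hd[of y FB] list.set_sel(1)[OF ne(2)] that unfolding FB_def prec_filter by auto
  have inv: "prec X y (last FA)" "prec X (hd FB) x" "prec X (hd FB) (last FA)"
    if "P x" "\<not> P y" "prec X y x" for x y
    using last[of x] first[of y] that prec_in_set[OF that(3)] trans by metis+
  show ?thesis
  proof (cases "compatible (hd (rev (coarse m A))) (hd (coarse m B))")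
    case True
    have "\<exists>Z. X = take i FA @ Z @ drop j FB \<and> Z \<in> shuffles (drop i FA) (take j FB)"
    proof (rule merge_with_local_inversions[OF D(1), where P = P])
      fix x y assume xy: "\<not> P y" "P x" "prec X y x"
      show "x \<notin> set (take i FA)"
      proof
        assume "x \<in> set (take i FA)"
        then obtain w where w: "w \<in> set FA" "w = x \<or> prec FA x w" "(5 \<le> f w) \<noteq> (5 \<le> f (last FA))"
          using before_tail_run[of x FA f] unfolding i_def cA len(1) by blast
        then have "P w" "prec X y w" using xy trans unfolding FA_def prec_filter by auto
        then show False
          using comp[of w y] comp[of "last FA" y] last[of x] inv(1)[of x y] xy w(3) prec_in_set[OF xy(3)]
          unfolding compatible_def by auto
      qed
      show "y \<notin> set (drop j FB)"
      proof
        assume "y \<in> set (drop j FB)"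
        then obtain w where w: "w \<in> set FB" "w = y \<or> prec FB w y" "(5 \<le> f w) \<noteq> (5 \<le> f (hd FB))"
          using after_head_run[of y f FB] unfolding j_def cB by blast
        then have "\<not> P w" "prec X w x" using xy trans unfolding FB_def prec_filter by auto
        then show False
          using comp[of x w] comp[of x "hd FB"] first[of y] inv(2)[of x y] xy w(3) prec_in_set[OF xy(3)]
          unfolding compatible_def by auto
      qed
    qed (simp_all add: FA_def[symmetric] FB_def[symmetric])
    then show ?thesis using True unfolding FA FB spread_def take_map drop_map by simp
  next
    case False
    have no: "\<not> prec X y x" if "P x" "\<not> P y" for x y
      using comp[OF _ _ inv(3)] last(1) first(1) False that prec_in_set[of X y x] unfolding hds by metis
    have "\<exists>Z. X = FA @ Z @ FB \<and> Z \<in> shuffles [] []"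
      by (rule merge_with_local_inversions[OF D(1), where P = P])
        (use no in \<open>auto simp: FA_def FB_def\<close>)
    then have "X = FA @ FB" by simp
    then have "X = take i FA @ (drop i FA @ take j FB) @ drop j FB" by simp
    then show ?thesis using False unfolding FA FB spread_def take_map drop_map by simp
  qed
qed

lemma card_merges_le:
  assumes m: "0 < m" and d: "\<delta> < 2" and A: "A \<in> orders (10 * m)" and B: "B \<in> orders (10 * m)"
  shows "card {X \<in> orders (20 * m). leads \<delta> X (20 * m) \<and> pick \<delta> X = A \<and> pick (1 - \<delta>) X = B}
    \<le> merge_bound (end_type (rev (coarse m A))) (end_type (coarse m B))" (is "card ?S \<le> _")
proof -
  define i where "i = 10 * m - head_run (rev (coarse m A))"
  define j where "j = head_run (coarse m B)"
  define F where "F = (if compatible (hd (rev (coarse m A))) (hd (coarse m B))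
         then shuffles (spread \<delta> (drop i A)) (spread (1 - \<delta>) (take j B))
         else {spread \<delta> (drop i A) @ spread (1 - \<delta>) (take j B)})"
  have "?S \<subseteq> (\<lambda>Z. spread \<delta> (take i A) @ Z @ spread (1 - \<delta>) (drop j B)) ` F"
    using merge_shape[OF m _ _ d] unfolding F_def i_def j_def by blast
  moreover have "finite F" unfolding F_def by simp
  ultimately have "card ?S \<le> card F"
    by (meson card_image_le card_mono finite_imageI le_trans)
  also have "card F \<le> merge_bound (end_type (rev (coarse m A))) (end_type (coarse m B))"
  proof -
    have "set (spread \<delta> (drop i A)) \<inter> set (spread (1 - \<delta>) (take j B)) = {}"
    proof -
      have "2 * x + \<delta> \<noteq> 2 * y + (1 - \<delta>)" for x y :: nat using d by presburger
      then show ?thesis unfolding spread_def by auto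
    qed
    moreover have "length (drop i A) = head_run (rev (coarse m A))" "length (take j B) = j"
      using head_run_le[of "rev (coarse m A)"] head_run_le[of "coarse m B"] ordersD(4)[OF A] ordersD(4)[OF B]
      unfolding i_def j_def by auto
    ultimately show ?thesis
      unfolding F_def merge_bound_def end_type_def j_def[symmetric] by (simp add: card_disjoint_shuffles)
  qed
  finally show ?thesis .
qed

lemma merge_end_types:
  assumes m: "0 < m" and X: "X \<in> orders (20 * m)" and lead: "leads \<delta> X (20 * m)" and d: "\<delta> < 2"
  defines "A \<equiv> coarse m (pick \<delta> X)" and "B \<equiv> coarse m (pick (1 - \<delta>) X)"
  assumes runs: "head_run A + head_run (rev A) < 10 * m" "head_run B + head_run (rev B) < 10 * m"
  shows "end_type (coarse (2 * m) X) = end_type A"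
    "end_type (rev (coarse (2 * m) X)) = end_type (rev B)"
proof -
  define i where "i = 10 * m - head_run (rev A)"
  define j where "j = head_run B"
  have len: "length A = 10 * m" "length B = 10 * m"
    unfolding A_def B_def using pick_orders[of X "10 * m"] X d ordersD(4) by simp_all
  obtain Z where Z: "X = spread \<delta> (take i (pick \<delta> X)) @ Z @ spread (1 - \<delta>) (drop j (pick (1 - \<delta>) X))"
    using merge_shape[OF m X lead d] unfolding i_def j_def A_def B_def by blast
  have "coarse (2 * m) X = coarse (2 * m) (spread \<delta> (take i (pick \<delta> X))) @ coarse (2 * m) Z @
      coarse (2 * m) (spread (1 - \<delta>) (drop j (pick (1 - \<delta>) X)))"
    by (subst Z) (simp add: coarse_def)
  also have "\<dots> = take i A @ coarse (2 * m) Z @ drop j B"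
    using d unfolding coarse_spread[OF d] A_def B_def
    by (subst coarse_spread) (simp_all add: coarse_def take_map drop_map)
  finally have c: "coarse (2 * m) X = take i A @ coarse (2 * m) Z @ drop j B" .
  show "end_type (coarse (2 * m) X) = end_type A"
    unfolding c using runs len by (intro end_type_take) (simp_all add: i_def)
  have "rev (coarse (2 * m) X) = take (10 * m - j) (rev B) @ rev (coarse (2 * m) Z) @ rev (take i A)"
    unfolding c using len by (simp add: rev_drop)
  moreover have "end_type \<dots> = end_type (rev B)"
    using runs len by (intro end_type_take) (simp_all add: j_def)
  ultimately show "end_type (rev (coarse (2 * m) X)) = end_type (rev B)" by simp
qed

section \<open>Doubling and the upper bound\<close>

lemma merge_bound_pos: "1 \<le> merge_bound s t"
  by (simp add: merge_bound_def Suc_le_eq)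

text \<open>
  An integer vector close to the dominant eigenvector of the nonnegative matrix
  \<open>2 (\<Sum>X. merge_bound s (beginning of X) \<cdot> [end of X = t])\<close>, indexed by types \<open>s\<close> and \<open>t\<close>,
  for the orders \<open>X\<close> on ten elements. Its spectral radius is about \<open>3008\<close>.
\<close>

definition end_weight :: "nat \<times> nat \<Rightarrow> nat" where
  "end_weight t = (let d = depth (fst t); r = snd t in
     if d = 0 then 12 else if d = 1 then 7 + (r + 1) * (r + 2) div 2 else 7 + r)"

text \<open>
  The types that occur at the ends of orders on ten elements, and hence of all orders on
  \<open>10 \<cdot> 2\<^sup>k\<close> elements.
\<close>

definition end_types :: "(nat \<times> nat) list" where
  "end_types = [(0, 1), (1, 1), (2, 1), (2, 2), (3, 1), (3, 2), (3, 3),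
     (4, 1), (4, 2), (4, 3), (4, 4), (5, 1), (5, 2), (5, 3), (5, 4),
     (6, 1), (6, 2), (6, 3), (7, 1), (7, 2), (8, 1), (9, 1)]"

text \<open>
  The entry at \<open>s\<close> of the matrix above, for \<open>10 m\<close> elements and without the factor two, applied to
  \<open>end_weight\<close>.
\<close>

definition boundary_sum :: "nat \<Rightarrow> nat \<times> nat \<Rightarrow> nat" where
  "boundary_sum m s = (\<Sum>X\<in>orders (10 * m).
     merge_bound s (end_type (coarse m X)) * end_weight (end_type (rev (coarse m X))))"

definition short_ends :: "nat \<Rightarrow> bool" where
  "short_ends m \<longleftrightarrow> (\<forall>X\<in>orders (10 * m).
     end_type (coarse m X) \<in> set end_types \<and> end_type (rev (coarse m X)) \<in> set end_types)"

lemma end_types_run: "t \<in> set end_types \<Longrightarrow> snd t \<le> 4"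
  by (auto simp: end_types_def)

text \<open>
  Runs have length at most four, so the first run and the final run of one class leave some
  elements between them. Hence an order begins with the first run of its leading class and the
  element after it, undisturbed by inversions, and similarly at the end.
\<close>

lemma short_ends_double:
  assumes m: "0 < m" and short: "short_ends m"
    and X: "X \<in> orders (20 * m)" and lead: "leads \<delta> X (20 * m)" and d: "\<delta> < 2"
  shows "end_type (coarse (2 * m) X) = end_type (coarse m (pick \<delta> X))"
    "end_type (rev (coarse (2 * m) X)) = end_type (rev (coarse m (pick (1 - \<delta>) X)))"
proof -
  have run: "head_run (coarse m A) + head_run (rev (coarse m A)) < 10 * m" if "A \<in> orders (10 * m)" for A
    using short that m end_types_run[of "end_type (coarse m A)"] end_types_run[of "end_type (rev (coarse m A))"]
    unfolding short_ends_def end_type_def by force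
  have "pick \<delta> X \<in> orders (10 * m)" "pick (1 - \<delta>) X \<in> orders (10 * m)"
    using pick_orders[of X "10 * m"] X d by simp_all
  note merge_end_types[OF m X lead d run[OF this(1)] run[OF this(2)]]
  then show "end_type (coarse (2 * m) X) = end_type (coarse m (pick \<delta> X))"
    "end_type (rev (coarse (2 * m) X)) = end_type (rev (coarse m (pick (1 - \<delta>) X)))" .
qed

text \<open>
  Each order on \<open>20 m\<close> elements is one of at most \<open>merge_bound\<close> gluings of two orders on \<open>10 m\<close>
  elements; the factor two accounts for the choice of the leading class.
\<close>

lemma boundary_sum_double:
  assumes m: "0 < m" and short: "short_ends m"
  shows "short_ends (2 * m)"
    "boundary_sum (2 * m) s \<le>
      2 * (\<Sum>A\<in>orders (10 * m). merge_bound s (end_type (coarse m A)) *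
              boundary_sum m (end_type (rev (coarse m A))))"
proof -
  define Os where "Os = orders (10 * m)"
  define lead where "lead = (\<lambda>X :: nat list. if prec X 0 1 then 0 else 1 :: nat)"
  define split where "split = (\<lambda>X. (lead X, pick (lead X) X, pick (1 - lead X) X))"
  define Rg where "Rg = {0, 1 :: nat} \<times> Os \<times> Os"
  define g where "g = (\<lambda>(\<delta> :: nat, A, B). merge_bound s (end_type (coarse m A)) *
    end_weight (end_type (rev (coarse m B))))"
  have eq20: "10 * (2 * m) = 20 * m" by simp
  have lead: "leads (lead X) X (20 * m)" "lead X < 2" if "X \<in> orders (20 * m)" for X
    using leads_exists[OF that] by (auto simp: lead_def)
  have split: "split ` orders (20 * m) \<subseteq> Rg"
  proof (rule image_subsetI)
    fix X assume "X \<in> orders (20 * m)"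
    then show "split X \<in> Rg"
      using pick_orders[of X "10 * m"] lead[of X] unfolding split_def Rg_def Os_def
      by (auto simp: lead_def)
  qed
  have types: "end_type (coarse (2 * m) X) = end_type (coarse m (pick (lead X) X))"
    "end_type (rev (coarse (2 * m) X)) = end_type (rev (coarse m (pick (1 - lead X) X)))"
    if "X \<in> orders (20 * m)" for X
    using short_ends_double[OF m short that lead[OF that]] .
  show "short_ends (2 * m)"
    unfolding short_ends_def eq20
  proof (intro ballI)
    fix X assume X: "X \<in> orders (20 * m)"
    then have "pick (lead X) X \<in> orders (10 * m)" "pick (1 - lead X) X \<in> orders (10 * m)"
      using pick_orders[of X "10 * m"] lead[OF X] by simp_all
    then show "end_type (coarse (2 * m) X) \<in> set end_types \<and> end_type (rev (coarse (2 * m) X)) \<in> set end_types"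
      using short types[OF X] unfolding short_ends_def by simp
  qed
  have fin: "finite (orders (20 * m))" "finite Os" "finite Rg"
    unfolding Rg_def Os_def by (simp_all add: finite_orders)
  have "boundary_sum (2 * m) s = (\<Sum>X\<in>orders (20 * m). g (split X))"
    unfolding boundary_sum_def eq20 by (rule sum.cong) (simp_all add: types g_def split_def)
  also have "\<dots> = (\<Sum>p\<in>Rg. card {X \<in> orders (20 * m). split X = p} * g p)"
    using sum_fun_comp[OF fin(1,3) split, of g] by simp
  also have "\<dots> \<le> (\<Sum>p\<in>Rg. (case p of (\<delta>, A, B) \<Rightarrow>
      merge_bound (end_type (rev (coarse m A))) (end_type (coarse m B))) * g p)"
  proof (intro sum_mono mult_right_mono)
    fix p assume "p \<in> Rg"
    then obtain \<delta> A B where p: "p = (\<delta>, A, B)" "\<delta> < 2" "A \<in> orders (10 * m)" "B \<in> orders (10 * m)"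
      unfolding Rg_def Os_def by auto
    have "card {X \<in> orders (20 * m). split X = p} \<le>
        card {X \<in> orders (20 * m). leads \<delta> X (20 * m) \<and> pick \<delta> X = A \<and> pick (1 - \<delta>) X = B}"
      using lead fin(1) by (intro card_mono) (auto simp: p(1) split_def)
    also have "\<dots> \<le> merge_bound (end_type (rev (coarse m A))) (end_type (coarse m B))"
      by (rule card_merges_le[OF m p(2-4)])
    finally show "card {X \<in> orders (20 * m). split X = p} \<le> (case p of (\<delta>, A, B) \<Rightarrow>
      merge_bound (end_type (rev (coarse m A))) (end_type (coarse m B)))"
      by (simp add: p(1))
  qed simp
  also have "\<dots> = (\<Sum>\<delta>\<in>{0, 1 :: nat}. \<Sum>A\<in>Os. \<Sum>B\<in>Os.
      merge_bound (end_type (rev (coarse m A))) (end_type (coarse m B)) *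
      (merge_bound s (end_type (coarse m A)) * end_weight (end_type (rev (coarse m B)))))"
    unfolding Rg_def g_def by (simp only: sum.cartesian_product' split_conv case_prod_beta fst_conv snd_conv)
  also have "\<dots> = 2 * (\<Sum>A\<in>Os. merge_bound s (end_type (coarse m A)) *
              boundary_sum m (end_type (rev (coarse m A))))"
    unfolding boundary_sum_def Os_def by (simp add: sum_distrib_left mult.left_commute flip: mult_2)
  finally show "boundary_sum (2 * m) s \<le>
      2 * (\<Sum>A\<in>orders (10 * m). merge_bound s (end_type (coarse m A)) *
              boundary_sum m (end_type (rev (coarse m A))))"
    unfolding Os_def .
qed

text \<open>
  Inserting the bound for \<open>m\<close> twice into \<open>boundary_sum_double\<close>, first for the second class and then for
  the leading one, squares the constant.
\<close>

lemma boundary_sum_power: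
  assumes short: "short_ends 1" and base: "\<And>s. s \<in> set end_types \<Longrightarrow> 2 * boundary_sum 1 s \<le> M * end_weight s"
  shows "short_ends (2 ^ k) \<and> (\<forall>s\<in>set end_types. 2 * boundary_sum (2 ^ k) s \<le> M ^ 2 ^ k * end_weight s)"
proof (induction k)
  case 0
  then show ?case using short base by simp
next
  case (Suc k)
  define m :: nat where "m = 2 ^ k"
  have m: "0 < m" by (simp add: m_def)
  have IH: "2 * boundary_sum m s \<le> M ^ m * end_weight s" if "s \<in> set end_types" for s
    using Suc.IH that unfolding m_def by blast
  have short: "short_ends m" using Suc.IH unfolding m_def by simp
  have "2 * boundary_sum (2 * m) s \<le> M ^ (2 * m) * end_weight s" if s: "s \<in> set end_types" for s
  proof -
    have "2 * boundary_sum (2 * m) s \<le> 2 * (\<Sum>A\<in>orders (10 * m). merge_bound s (end_type (coarse m A)) *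
              (2 * boundary_sum m (end_type (rev (coarse m A)))))"
      using mult_le_mono2[OF boundary_sum_double(2)[OF m short, of s], of 2]
      by (simp add: sum_distrib_left mult.left_commute)
    also have "\<dots> \<le> 2 * (\<Sum>A\<in>orders (10 * m). merge_bound s (end_type (coarse m A)) *
              (M ^ m * end_weight (end_type (rev (coarse m A)))))"
      using short IH unfolding short_ends_def by (intro mult_left_mono sum_mono) auto
    also have "\<dots> = M ^ m * (2 * boundary_sum m s)"
      unfolding boundary_sum_def by (simp add: sum_distrib_left mult.left_commute)
    also have "\<dots> \<le> M ^ m * (M ^ m * end_weight s)"
      using IH[OF s] by simp
    also have "\<dots> = M ^ (2 * m) * end_weight s" by (simp add: mult_2 power_add)
    finally show ?thesis .
  qed
  then show ?case using boundary_sum_double(1)[OF m short] by (simp add: m_def)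
qed

lemma card_orders_le:
  assumes short: "short_ends 1" and base: "\<And>s. s \<in> set end_types \<Longrightarrow> 2 * boundary_sum 1 s \<le> M * end_weight s"
  shows "card (orders (10 * 2 ^ k)) \<le> 12 * M ^ 2 ^ k"
proof -
  have "card (orders (10 * 2 ^ k)) = (\<Sum>X\<in>orders (10 * 2 ^ k). 1)" by simp
  also have "\<dots> \<le> boundary_sum (2 ^ k) (0, 1)"
    unfolding boundary_sum_def
  proof (rule sum_mono)
    fix X
    have "1 * 1 \<le> merge_bound (0, 1) (end_type (coarse (2 ^ k) X)) * end_weight (end_type (rev (coarse (2 ^ k) X)))"
      by (rule mult_mono[OF merge_bound_pos]) (simp_all add: end_weight_def Let_def)
    then show "1 \<le> merge_bound (0, 1) (end_type (coarse (2 ^ k) X)) * end_weight (end_type (rev (coarse (2 ^ k) X)))"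
      by simp
  qed
  also have "\<dots> \<le> 2 * boundary_sum (2 ^ k) (0, 1)" by simp
  also have "\<dots> \<le> M ^ 2 ^ k * end_weight (0, 1)"
    using boundary_sum_power[OF short base, of k] by (auto simp: end_types_def)
  also have "end_weight (0, 1) = 12" by (simp add: end_weight_def depth_def)
  finally show ?thesis by (simp add: mult.commute)
qed

section \<open>Doubling and the lower bound\<close>

lemma extremal_excludes_progression:
  assumes "extremal N y z" "x < N"
  shows "x + z \<noteq> 2 * y"
  using assms by (cases "y \<le> z") (auto simp: extremal_def min_def max_def split: if_splits)

lemma extremal_sym: "extremal N x y \<longleftrightarrow> extremal N y x"
  by (simp add: extremal_def min.commute max.commute)

text \<open>
  The converse of \<open>inversion_is_extremal\<close>: only a progression whose outer terms lie in one class and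
  whose middle term lies in the other could be violated, and then one of the two comparisons of
  adjacent terms is an inversion.
\<close>

lemma merge_in_orders:
  assumes X: "distinct X" "set X = {..<2 * n}"
    and A: "filter (\<lambda>x. x mod 2 = \<delta>) X = spread \<delta> A" "ap_free A"
    and B: "filter (\<lambda>x. x mod 2 \<noteq> \<delta>) X = spread \<epsilon> B" "ap_free B"
    and inv: "\<And>x y. x mod 2 = \<delta> \<Longrightarrow> y mod 2 \<noteq> \<delta> \<Longrightarrow> prec X y x \<Longrightarrow> extremal (2 * n) x y"
  shows "X \<in> orders (2 * n)"
proof -
  have "x + z \<noteq> 2 * y" if p: "prec X x y" "prec X y z" for x y z
  proof
    assume eq: "x + z = 2 * y"
    then have par: "x mod 2 = z mod 2" by presburger
    have lt: "x < 2 * n" "z < 2 * n" using prec_in_set[OF p(1)] prec_in_set[OF p(2)] X(2) by auto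
    consider "x mod 2 = \<delta>" "y mod 2 = \<delta>" | "x mod 2 \<noteq> \<delta>" "y mod 2 \<noteq> \<delta>"
      | "x mod 2 = \<delta>" "y mod 2 \<noteq> \<delta>" | "x mod 2 \<noteq> \<delta>" "y mod 2 = \<delta>" by blast
    then show False
    proof cases
      case 1
      then have "prec (spread \<delta> A) x y" "prec (spread \<delta> A) y z"
        using p par unfolding A(1)[symmetric] prec_filter by auto
      then show False using A(2) eq ap_free_spread[of \<delta> A] unfolding ap_free_def by blast
    next
      case 2
      then have "prec (spread \<epsilon> B) x y" "prec (spread \<epsilon> B) y z"
        using p par unfolding B(1)[symmetric] prec_filter by auto
      then show False using B(2) eq ap_free_spread[of \<epsilon> B] unfolding ap_free_def by blast
    next
      case 3
      then have "extremal (2 * n) y z" using inv[of z y] p par extremal_sym by auto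
      then show False using extremal_excludes_progression[OF _ lt(1)] eq by blast
    next
      case 4
      then have "extremal (2 * n) y x" using inv[of y x] p by auto
      then show False using extremal_excludes_progression[OF _ lt(2), of y x] eq by (simp add: add.commute)
    qed
  qed
  then show ?thesis using X unfolding orders_def ap_free_def by blast
qed

text \<open>
  The gluings used for the lower bound. The flag says whether the last element of the leading class
  \<open>\<delta>\<close> is exchanged with the first element of the other class.
\<close>

fun concat_merge :: "nat \<times> nat list \<times> nat list \<times> bool \<Rightarrow> nat list" where
  "concat_merge (\<delta>, A, B, False) = spread \<delta> A @ spread (1 - \<delta>) B"
| "concat_merge (\<delta>, A, B, True) =
     spread \<delta> (butlast A) @ [2 * hd B + (1 - \<delta>), 2 * last A + \<delta>] @ spread (1 - \<delta>) (tl B)"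

lemma spread_mod: "\<delta> < 2 \<Longrightarrow> x \<in> set (spread \<delta> A) \<Longrightarrow> x mod 2 = \<delta>"
  by (auto simp: spread_def)

lemma filter_spread:
  assumes "\<delta> < 2" "\<epsilon> < 2"
  shows "filter (\<lambda>x. x mod 2 = \<delta>) (spread \<epsilon> A) = (if \<epsilon> = \<delta> then spread \<delta> A else [])"
  using spread_mod[OF assms(2)] by (auto simp: filter_id_conv filter_empty_conv)

lemma set_spreads:
  assumes "\<delta> < 2" "set A = {..<n}" "set B = {..<n}"
  shows "set (spread \<delta> A) \<union> set (spread (1 - \<delta>) B) = {..<2 * n}"
proof -
  have "x \<in> (\<lambda>x. 2 * x + \<delta>) ` {..<n} \<union> (\<lambda>x. 2 * x + (1 - \<delta>)) ` {..<n} \<longleftrightarrow> x < 2 * n" for x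
  proof
    assume x: "x < 2 * n"
    have "x = 2 * (x div 2) + \<delta> \<or> x = 2 * (x div 2) + (1 - \<delta>)" using assms(1) by presburger
    moreover have "x div 2 \<in> {..<n}" using x by auto
    ultimately show "x \<in> (\<lambda>x. 2 * x + \<delta>) ` {..<n} \<union> (\<lambda>x. 2 * x + (1 - \<delta>)) ` {..<n}" by blast
  qed (use assms(1) in auto)
  then show ?thesis unfolding spread_def set_map assms(2,3) by blast
qed

lemma spread_butlast: "A \<noteq> [] \<Longrightarrow> spread \<delta> (butlast A) @ [2 * last A + \<delta>] = spread \<delta> A"
  by (cases A rule: rev_cases) (simp_all add: spread_def)

lemma concat_merge_facts:
  assumes d: "\<delta> < 2" and ne: "A \<noteq> []" "B \<noteq> []"
  shows "filter (\<lambda>x. x mod 2 = \<delta>) (concat_merge (\<delta>, A, B, b)) = spread \<delta> A"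
    "filter (\<lambda>x. x mod 2 = 1 - \<delta>) (concat_merge (\<delta>, A, B, b)) = spread (1 - \<delta>) B"
    "mset (concat_merge (\<delta>, A, B, b)) = mset (spread \<delta> A @ spread (1 - \<delta>) B)"
proof -
  define \<epsilon> where "\<epsilon> = 1 - \<delta>"
  have e: "\<epsilon> < 2" "\<epsilon> \<noteq> \<delta>" using d unfolding \<epsilon>_def by presburger+
  have A: "spread \<delta> (butlast A) @ [2 * last A + \<delta>] = spread \<delta> A"
    using ne(1) by (rule spread_butlast)
  have B: "(2 * hd B + \<epsilon>) # spread \<epsilon> (tl B) = spread \<epsilon> B"
    using ne(2) by (cases B) (simp_all add: spread_def)
  have m: "(2 * hd B + \<epsilon>) mod 2 = \<epsilon>" "(2 * last A + \<delta>) mod 2 = \<delta>"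
    using d e by simp_all
  have X: "concat_merge (\<delta>, A, B, b) = (if b then spread \<delta> (butlast A) @
      [2 * hd B + \<epsilon>, 2 * last A + \<delta>] @ spread \<epsilon> (tl B) else spread \<delta> A @ spread \<epsilon> B)"
    unfolding \<epsilon>_def by (cases b) simp_all
  show "filter (\<lambda>x. x mod 2 = \<delta>) (concat_merge (\<delta>, A, B, b)) = spread \<delta> A"
    using A m d e unfolding X by (simp add: filter_spread)
  show "filter (\<lambda>x. x mod 2 = 1 - \<delta>) (concat_merge (\<delta>, A, B, b)) = spread (1 - \<delta>) B"
    using B m d e unfolding X \<epsilon>_def[symmetric] by (simp add: filter_spread)
  show "mset (concat_merge (\<delta>, A, B, b)) = mset (spread \<delta> A @ spread (1 - \<delta>) B)"
    unfolding X \<epsilon>_def[symmetric] A[symmetric] B[symmetric] by simp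
qed

lemma concat_merge_orders:
  assumes d: "\<delta> < 2" and A: "A \<in> orders n" and B: "B \<in> orders n" and n: "0 < n"
    and b: "b \<Longrightarrow> extremal (2 * n) (2 * last A + \<delta>) (2 * hd B + (1 - \<delta>))"
  shows "concat_merge (\<delta>, A, B, b) \<in> orders (2 * n)"
proof -
  note DA = ordersD[OF A] and DB = ordersD[OF B]
  have ne: "A \<noteq> []" "B \<noteq> []" using DA(4) DB(4) n by auto
  note facts = concat_merge_facts[OF d ne, of b]
  have d': "1 - \<delta> < 2" and d'': "\<delta> \<noteq> 1 - \<delta>" using d by presburger+
  have odd: "(\<lambda>x::nat. x mod 2 \<noteq> \<delta>) = (\<lambda>x. x mod 2 = 1 - \<delta>)"
    using d by (intro ext) presburger
  have "distinct (spread \<delta> A @ spread (1 - \<delta>) B)"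
  proof -
    have "distinct (spread \<delta> A)" "distinct (spread (1 - \<delta>) B)"
      using DA(1) DB(1) unfolding spread_def by (simp_all add: distinct_map inj_on_def)
    moreover have "set (spread \<delta> A) \<inter> set (spread (1 - \<delta>) B) = {}"
      using spread_mod[OF d, of _ A] spread_mod[OF d', of _ B] d'' by force
    ultimately show ?thesis by simp
  qed
  then have dist: "distinct (concat_merge (\<delta>, A, B, b))"
    using mset_eq_imp_distinct_iff[OF facts(3)] by blast
  have set: "set (concat_merge (\<delta>, A, B, b)) = {..<2 * n}"
    using mset_eq_setD[OF facts(3)] set_spreads[OF d DA(2) DB(2)] by simp
  show ?thesis
  proof (rule merge_in_orders[OF dist set facts(1) DA(3)])
    show "filter (\<lambda>x. x mod 2 \<noteq> \<delta>) (concat_merge (\<delta>, A, B, b)) = spread (1 - \<delta>) B"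
      unfolding odd by (rule facts(2))
    show "ap_free B" by (rule DB(3))
    fix x y assume xy: "x mod 2 = \<delta>" "y mod 2 \<noteq> \<delta>" "prec (concat_merge (\<delta>, A, B, b)) y x"
    have nA: "y \<notin> set (spread \<delta> A')" for A' using spread_mod[OF d] xy(2) by blast
    have nB: "x \<notin> set (spread (1 - \<delta>) B')" for B'
      using spread_mod[OF d', of x B'] xy(1) d'' by (metis)
    have nAB: "\<not> prec (spread \<delta> A') y x \<and> \<not> prec (spread (1 - \<delta>) B') y x" for A' B'
      using prec_in_set[of "spread \<delta> A'" y x] prec_in_set[of "spread (1 - \<delta>) B'" y x] nA nB by blast
    define \<epsilon> where "\<epsilon> = 1 - \<delta>"
    note no = nA nB[folded \<epsilon>_def] nAB[folded \<epsilon>_def]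
    have X: "concat_merge (\<delta>, A, B, b) = (if b then spread \<delta> (butlast A) @
        [2 * hd B + \<epsilon>, 2 * last A + \<delta>] @ spread \<epsilon> (tl B) else spread \<delta> A @ spread \<epsilon> B)"
      unfolding \<epsilon>_def by (cases b) simp_all
    have "b \<and> y = 2 * hd B + \<epsilon> \<and> x = 2 * last A + \<delta>"
      using xy(3) no unfolding X by (simp add: prec_append split: if_splits)
    then show "extremal (2 * n) x y" using b unfolding \<epsilon>_def by simp
  qed
qed

lemma inj_concat_merge:
  assumes n: "2 \<le> n"
  shows "inj_on concat_merge ({0, 1} \<times> orders n \<times> orders n \<times> UNIV)"
proof (rule inj_onI)
  fix p q
  assume "p \<in> {0, 1} \<times> orders n \<times> orders n \<times> UNIV" "q \<in> {0, 1} \<times> orders n \<times> orders n \<times> UNIV"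
    and "concat_merge p = concat_merge q"
  then obtain \<delta> A B b \<delta>' A' B' b' where p: "p = (\<delta>, A, B, b)" and q: "q = (\<delta>', A', B', b')"
    and dd: "\<delta> \<in> {0, 1}" "\<delta>' \<in> {0, 1}"
    and O: "A \<in> orders n" "B \<in> orders n" "A' \<in> orders n" "B' \<in> orders n"
    and eq: "concat_merge (\<delta>, A, B, b) = concat_merge (\<delta>', A', B', b')"
    by (cases p; cases q) blast
  have d: "\<delta> < 2" "\<delta>' < 2" using dd by auto
  have ne: "butlast A \<noteq> []" "A \<noteq> []" "B \<noteq> []" if "A \<in> orders n" "B \<in> orders n" for A B
    using ordersD(4)[OF that(1)] ordersD(4)[OF that(2)] n by (auto simp: butlast_conv_take)
  have hd: "hd (concat_merge (\<delta>, A, B, b)) mod 2 = \<delta>" if "A \<in> orders n" "B \<in> orders n" "\<delta> < 2" for \<delta> A B b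
  proof -
    have "hd (spread \<delta> A' @ Y) mod 2 = \<delta>" if "A' \<noteq> []" for A' Y
      using that \<open>\<delta> < 2\<close> by (cases A') (simp_all add: spread_def)
    then show ?thesis using ne[OF that(1,2)] by (cases b) simp_all
  qed
  have \<delta>: "\<delta>' = \<delta>" using hd[OF O(1,2) d(1), of b] hd[OF O(3,4) d(2), of b'] eq by simp
  note F = concat_merge_facts[OF d(1) ne(2,3)[OF O(1,2)], of b]
  note F' = concat_merge_facts[OF d(2) ne(2,3)[OF O(3,4)], of b']
  have e: "1 - \<delta> < 2" using d(1) by presburger
  have same: "spread \<delta> A = spread \<delta> A'" "spread (1 - \<delta>) B = spread (1 - \<delta>) B'"
    using trans[OF F(1)[symmetric, unfolded eq \<delta>] F'(1)[unfolded \<delta>]]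
      trans[OF F(2)[symmetric, unfolded eq \<delta>] F'(2)[unfolded \<delta>]] .
  have A: "A = A'" using arg_cong[OF same(1), of "pick \<delta>"] unfolding pick_spread[OF d(1)] .
  have B: "B = B'" using arg_cong[OF same(2), of "pick (1 - \<delta>)"] unfolding pick_spread[OF e] .
  have "concat_merge (\<delta>, A, B, False) \<noteq> concat_merge (\<delta>, A, B, True)"
  proof -
    have "spread \<delta> A = spread \<delta> (butlast A) @ [2 * last A + \<delta>]"
      using spread_butlast[OF ne(2)[OF O(1,2)]] by simp
    moreover have "2 * last A + \<delta> \<noteq> 2 * hd B + (1 - \<delta>)" using d(1) by presburger
    ultimately show ?thesis by simp
  qed
  moreover have "concat_merge (\<delta>, A, B, b) = concat_merge (\<delta>, A, B, b')"
    using eq unfolding \<delta> A[symmetric] B[symmetric] .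
  ultimately have "b = b'" by (metis (full_types))
  then show "p = q" unfolding p q using \<delta> A B by blast
qed

lemma card_orders_double_ge:
  assumes n: "2 \<le> n"
  shows "2 * card (orders n) ^ 2 +
      (\<Sum>\<delta>\<in>{0, 1}. card {(A, B) \<in> orders n \<times> orders n. extremal (2 * n) (2 * last A + \<delta>) (2 * hd B + (1 - \<delta>))})
    \<le> card (orders (2 * n))"
proof -
  define E where "E = (\<lambda>\<delta>. {(A, B) \<in> orders n \<times> orders n. extremal (2 * n) (2 * last A + \<delta>) (2 * hd B + (1 - \<delta>))})"
  define D1 where "D1 = {0, 1 :: nat} \<times> orders n \<times> orders n \<times> {False}"
  define D2 where "D2 = (\<lambda>(\<delta>, A, B). (\<delta>, A, B, True)) ` (SIGMA \<delta>:{0, 1 :: nat}. E \<delta>)"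
  have finE: "finite (E \<delta>)" for \<delta>
    unfolding E_def by (rule finite_subset[of _ "orders n \<times> orders n"]) (auto simp: finite_orders)
  have fin: "finite D1" "finite D2" unfolding D1_def D2_def using finE by (auto simp: finite_orders)
  have "card (D1 \<union> D2) \<le> card (orders (2 * n))"
  proof (rule card_inj_on_le[OF _ _ finite_orders])
    show "inj_on concat_merge (D1 \<union> D2)"
      by (rule inj_on_subset[OF inj_concat_merge[OF n]]) (auto simp: D1_def D2_def E_def)
    show "concat_merge ` (D1 \<union> D2) \<subseteq> orders (2 * n)"
    proof (rule image_subsetI)
      fix p assume "p \<in> D1 \<union> D2"
      then consider \<delta> A B where "p = (\<delta>, A, B, False)" "\<delta> < 2" "A \<in> orders n" "B \<in> orders n"
        | \<delta> A B where "p = (\<delta>, A, B, True)" "\<delta> < 2" "A \<in> orders n" "B \<in> orders n"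
          "extremal (2 * n) (2 * last A + \<delta>) (2 * hd B + (1 - \<delta>))"
        unfolding D1_def D2_def E_def by auto
      then show "concat_merge p \<in> orders (2 * n)"
        using concat_merge_orders n by cases (simp_all del: concat_merge.simps)
    qed
  qed
  moreover have "card (D1 \<union> D2) = card D1 + card D2"
    by (rule card_Un_disjoint[OF fin]) (auto simp: D1_def D2_def)
  moreover have "card D1 = 2 * card (orders n) ^ 2"
    unfolding D1_def by (simp add: card_cartesian_product power2_eq_square)
  moreover have "card D2 = (\<Sum>\<delta>\<in>{0, 1}. card (E \<delta>))"
    unfolding D2_def using finE by (subst card_image) (auto simp: inj_on_def card_SigmaI)
  ultimately show ?thesis unfolding E_def by simp
qed

text \<open>
  Reversal turns the distribution of the last element into that of the first element.
\<close>

lemma card_pairs_by_ends: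
  assumes n: "0 < n"
  shows "card {(A, B) \<in> orders n \<times> orders n. R (last A) (hd B)} =
    (\<Sum>l<n. \<Sum>f<n. card {X \<in> orders n. hd X = l} * card {X \<in> orders n. hd X = f} * of_bool (R l f))"
proof -
  define h where "h y = card {X \<in> orders n. hd X = y}" for y
  have hdlt: "hd X < n \<and> last X < n" if "X \<in> orders n" for X
    using ordersD(2,4)[OF that] hd_in_set[of X] last_in_set[of X] n by (cases "X = []") auto
  have last: "card {X \<in> orders n. last X = y} = h y" for y
    unfolding h_def
  proof (rule bij_betw_same_card[of rev])
    show "bij_betw rev {X \<in> orders n. last X = y} {X \<in> orders n. hd X = y}"
      by (rule bij_betw_byWitness[where f' = rev]) (auto simp: rev_orders hd_rev last_rev)
  qed
  have by_hd: "(\<Sum>X\<in>orders n. g (hd X)) = (\<Sum>y<n. h y * g y)" for g :: "nat \<Rightarrow> nat"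
    using sum_fun_comp[OF finite_orders finite_lessThan, of hd n n g] hdlt
    unfolding h_def by (simp add: image_subset_iff)
  have by_last: "(\<Sum>X\<in>orders n. g (last X)) = (\<Sum>y<n. h y * g y)" for g :: "nat \<Rightarrow> nat"
    using sum_fun_comp[OF finite_orders finite_lessThan, of last n n g] hdlt
    unfolding last by (simp add: image_subset_iff)
  have "card {(A, B) \<in> orders n \<times> orders n. R (last A) (hd B)} =
      (\<Sum>A\<in>orders n. \<Sum>B\<in>orders n. of_bool (R (last A) (hd B)))"
  proof -
    have "{(A, B) \<in> orders n \<times> orders n. R (last A) (hd B)} =
        (SIGMA A:orders n. {B \<in> orders n. R (last A) (hd B)})" by auto
    then show ?thesis by (simp add: card_SigmaI finite_orders sum_of_bool_eq Int_def)
  qed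
  also have "\<dots> = (\<Sum>A\<in>orders n. \<Sum>f<n. h f * of_bool (R (last A) f))"
    by (rule sum.cong[OF refl], rule by_hd)
  also have "\<dots> = (\<Sum>l<n. h l * (\<Sum>f<n. h f * of_bool (R l f)))"
    by (rule by_last)
  finally show ?thesis by (simp only: h_def sum_distrib_left mult.assoc)
qed

text \<open>
  By \<open>\<theta>(2 n) \<ge> 2 \<theta>(n)\<^sup>2\<close> the quantity \<open>2 \<theta>(n)\<close> is at least squared when \<open>n\<close> doubles.
\<close>

lemma card_orders_power_ge:
  assumes n: "2 \<le> n" and c: "c \<le> 2 * card (orders n)"
  shows "c ^ 2 ^ k \<le> 2 * card (orders (n * 2 ^ k))"
proof (induction k)
  case (Suc k)
  have n': "2 \<le> n * 2 ^ k"
    using n mult_le_mono[of 2 n 1 "2 ^ k"] by simp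
  have "c ^ 2 ^ Suc k = (c ^ 2 ^ k) ^ 2" by (simp add: power_mult[symmetric] mult.commute)
  also have "\<dots> \<le> (2 * card (orders (n * 2 ^ k))) ^ 2"
    using Suc by (rule power_mono) simp
  also have "\<dots> = 2 * (2 * card (orders (n * 2 ^ k)) ^ 2)" by (simp add: power2_eq_square)
  also have "\<dots> \<le> 2 * card (orders (2 * (n * 2 ^ k)))"
    using card_orders_double_ge[OF n'] by (intro mult_left_mono) auto
  finally show ?case by (simp add: mult.left_commute)
qed (use c in simp)

section \<open>The orders on eight and on ten elements\<close>

text \<open>
  Orders are built from the front, with a Boolean list \<open>S\<close> marking the values already placed. A value
  \<open>y\<close> may come next iff no progression around \<open>y\<close> has exactly one of its outer terms placed, that is,
  iff the marks to the left of \<open>y\<close> mirror those to its right as far as both exist.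
\<close>

fun mirrored :: "bool list \<Rightarrow> bool list \<Rightarrow> bool" where
  "mirrored (p # ps) (q # qs) \<longleftrightarrow> p = q \<and> mirrored ps qs"
| "mirrored _ _ \<longleftrightarrow> True"

definition playable :: "bool list \<Rightarrow> nat \<Rightarrow> bool" where
  "playable S y \<longleftrightarrow> \<not> S ! y \<and> mirrored (rev (take y S)) (drop (Suc y) S)"

fun completions :: "nat \<Rightarrow> bool list \<Rightarrow> nat list list" where
  "completions 0 S = [[]]"
| "completions (Suc k) S =
     concat (map (\<lambda>y. map ((#) y) (completions k (S[y := True])))
       (filter (playable S) [0..<length S]))"

lemma mirrored_iff:
  "mirrored ps qs \<longleftrightarrow> (\<forall>i < min (length ps) (length qs). ps ! i = qs ! i)"
proof (induction ps qs rule: mirrored.induct)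
  case (1 p ps q qs)
  have "(\<forall>i < Suc k. Q i) \<longleftrightarrow> Q 0 \<and> (\<forall>i < k. Q (Suc i))" for k and Q :: "nat \<Rightarrow> bool"
    using less_Suc_eq_0_disj by auto
  then show ?case using 1 by simp
qed auto

lemma playable_iff:
  assumes y: "y < length S"
  shows "playable S y \<longleftrightarrow> \<not> S ! y \<and>
    (\<forall>x<length S. \<forall>z<length S. S ! x \<longrightarrow> \<not> S ! z \<longrightarrow> x + z \<noteq> 2 * y)"
proof (cases "S ! y")
  case False
  have "mirrored (rev (take y S)) (drop (Suc y) S) \<longleftrightarrow>
      (\<forall>i. i < y \<and> Suc y + i < length S \<longrightarrow> S ! (y - Suc i) = S ! (Suc y + i))" (is "_ \<longleftrightarrow> ?M")
    using y unfolding mirrored_iff by (auto simp: rev_nth min_def)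
  also have "\<dots> \<longleftrightarrow> (\<forall>x<length S. \<forall>z<length S. S ! x \<longrightarrow> \<not> S ! z \<longrightarrow> x + z \<noteq> 2 * y)" (is "_ \<longleftrightarrow> ?R")
  proof
    assume M: ?M
    show ?R
    proof (intro allI impI notI)
      fix x z assume xz: "x < length S" "z < length S" "S ! x" "\<not> S ! z" and eq: "x + z = 2 * y"
      have "x \<noteq> z" using xz by blast
      then consider "x < y" | "z < y" using eq by linarith
      then show False
      proof cases
        case 1
        then have "y - Suc (y - Suc x) = x" "Suc y + (y - Suc x) = z" using eq by linarith+
        then show False using M[rule_format, of "y - Suc x"] 1 xz by simp
      next
        case 2
        then have "y - Suc (y - Suc z) = z" "Suc y + (y - Suc z) = x" using eq by linarith+
        then show False using M[rule_format, of "y - Suc z"] 2 xz by simp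
      qed
    qed
  next
    assume R: ?R
    show ?M
    proof (intro allI impI)
      fix i assume i: "i < y \<and> Suc y + i < length S"
      then have lt: "y - Suc i < length S" "Suc y + i < length S" and
        eq: "y - Suc i + (Suc y + i) = 2 * y" "Suc y + i + (y - Suc i) = 2 * y" by linarith+
      show "S ! (y - Suc i) = S ! (Suc y + i)"
        using R lt eq by blast
    qed
  qed
  finally show ?thesis using False unfolding playable_def by blast
qed (simp add: playable_def)

text \<open>
  The condition on the rest \<open>ys\<close> of an order after the values in \<open>U\<close>, whose arrangement
  no longer matters.
\<close>

definition ap_free_after :: "nat set \<Rightarrow> nat list \<Rightarrow> bool" where
  "ap_free_after U ys \<longleftrightarrow> ap_free ys \<and> (\<forall>x\<in>U. \<forall>y z. prec ys y z \<longrightarrow> x + z \<noteq> 2 * y)"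

lemma ap_free_after_Cons:
  assumes "y \<notin> set ys"
  shows "ap_free_after U (y # ys) \<longleftrightarrow>
    (\<forall>x\<in>U. \<forall>z\<in>set ys. x + z \<noteq> 2 * y) \<and> ap_free_after (insert y U) ys"
proof -
  have "ap_free (y # ys) \<longleftrightarrow> ap_free ys \<and> (\<forall>b c. prec ys b c \<longrightarrow> y + c \<noteq> 2 * b)" (is "?L \<longleftrightarrow> ?R")
  proof
    assume L: ?L
    have "y + c \<noteq> 2 * b" if "prec ys b c" for b c
      using L[unfolded ap_free_def, rule_format, of y b c] prec_in_set[OF that] that by simp
    moreover have "a + c \<noteq> 2 * b" if "prec ys a b" "prec ys b c" for a b c
      using L[unfolded ap_free_def, rule_format, of a b c] that by simp
    ultimately show ?R unfolding ap_free_def by blast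
  next
    assume R: ?R
    have "a + c \<noteq> 2 * b" if "prec (y # ys) a b" "prec (y # ys) b c" for a b c
    proof -
      have "b \<in> set ys" using that(1) prec_in_set[of ys a b] by auto
      then have "b \<noteq> y" using assms by blast
      then have "prec ys b c" "a = y \<or> prec ys a b" using that by simp_all blast
      then show ?thesis using R unfolding ap_free_def by blast
    qed
    then show ?L unfolding ap_free_def by blast
  qed
  moreover have "(\<forall>x\<in>U. \<forall>b c. prec (y # ys) b c \<longrightarrow> x + c \<noteq> 2 * b) \<longleftrightarrow>
      (\<forall>x\<in>U. \<forall>z\<in>set ys. x + z \<noteq> 2 * y) \<and> (\<forall>x\<in>U. \<forall>b c. prec ys b c \<longrightarrow> x + c \<noteq> 2 * b)"
    unfolding prec.simps by blast
  ultimately show ?thesis unfolding ap_free_after_def by blast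
qed

lemma set_completions:
  assumes "k = card {i. i < length S \<and> \<not> S ! i}"
  shows "set (completions k S) =
    {ys. distinct ys \<and> set ys = {i. i < length S \<and> \<not> S ! i} \<and>
      ap_free_after {i. i < length S \<and> S ! i} ys}"
  using assms
proof (induction k arbitrary: S)
  case 0
  then have F: "{i. i < length S \<and> \<not> S ! i} = {}" by (subst (asm) eq_commute) simp
  show ?case unfolding F by (auto simp: ap_free_after_def ap_free_def)
next
  case (Suc k)
  define F where "F = {i. i < length S \<and> \<not> S ! i}"
  define U where "U = {i. i < length S \<and> S ! i}"
  have rec: "ys \<in> set (completions k (S[y := True])) \<longleftrightarrow>
      distinct ys \<and> set ys = F - {y} \<and> ap_free_after (insert y U) ys" if y: "y \<in> F" for y ys
  proof -
    have F': "{i. i < length (S[y := True]) \<and> \<not> S[y := True] ! i} = F - {y}"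
      and U': "{i. i < length (S[y := True]) \<and> S[y := True] ! i} = insert y U"
      using y by (auto simp: nth_list_update F_def U_def)
    have "k = card (F - {y})" using Suc.prems y by (simp add: F_def)
    then show ?thesis using Suc.IH[of "S[y := True]"] unfolding F' U' by simp
  qed
  have play: "y < length S \<and> playable S y \<longleftrightarrow> y \<in> F \<and> (\<forall>x\<in>U. \<forall>z\<in>F - {y}. x + z \<noteq> 2 * y)" for y
  proof (cases "y < length S")
    case True
    have "x + y \<noteq> 2 * y" if "x \<in> U" "y \<in> F" for x
      using that by (auto simp: F_def U_def)
    then have "y \<in> F \<and> (\<forall>x\<in>U. \<forall>z\<in>F. x + z \<noteq> 2 * y) \<longleftrightarrow>
        y \<in> F \<and> (\<forall>x\<in>U. \<forall>z\<in>F - {y}. x + z \<noteq> 2 * y)"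
      by blast
    moreover have "playable S y \<longleftrightarrow> y \<in> F \<and> (\<forall>x\<in>U. \<forall>z\<in>F. x + z \<noteq> 2 * y)"
      unfolding playable_iff[OF True] using True unfolding F_def U_def by blast
    ultimately show ?thesis using True by blast
  qed (simp add: F_def)
  have "xs \<in> set (completions (Suc k) S) \<longleftrightarrow>
      distinct xs \<and> set xs = F \<and> ap_free_after U xs" for xs
  proof (cases xs)
    case Nil
    have "F \<noteq> {}" using Suc.prems unfolding F_def[symmetric] by (metis card.empty nat.distinct(1))
    then show ?thesis using Nil by auto
  next
    case (Cons y ys)
    have "xs \<in> set (completions (Suc k) S) \<longleftrightarrow>
        (y < length S \<and> playable S y) \<and> ys \<in> set (completions k (S[y := True]))"
      unfolding Cons by auto
    also have "\<dots> \<longleftrightarrow> y \<in> F \<and> (\<forall>x\<in>U. \<forall>z\<in>F - {y}. x + z \<noteq> 2 * y) \<and>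
        distinct ys \<and> set ys = F - {y} \<and> ap_free_after (insert y U) ys"
      unfolding play using rec[of y ys] by blast
    also have "\<dots> \<longleftrightarrow> y \<in> F \<and> y \<notin> set ys \<and> distinct ys \<and> set ys = F - {y} \<and>
        (\<forall>x\<in>U. \<forall>z\<in>set ys. x + z \<noteq> 2 * y) \<and> ap_free_after (insert y U) ys"
      by (cases "set ys = F - {y}") auto
    also have "\<dots> \<longleftrightarrow> y \<in> F \<and> y \<notin> set ys \<and> distinct ys \<and> set ys = F - {y} \<and> ap_free_after U xs"
      unfolding Cons using ap_free_after_Cons[of y ys U] by blast
    also have "\<dots> \<longleftrightarrow> distinct xs \<and> set xs = F \<and> ap_free_after U xs"
    proof -
      have "y \<in> F \<and> y \<notin> set ys \<and> set ys = F - {y} \<longleftrightarrow> y \<notin> set ys \<and> insert y (set ys) = F"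
        by blast
      then show ?thesis unfolding Cons distinct.simps list.set by blast
    qed
    finally show ?thesis .
  qed
  then show ?case unfolding F_def U_def by (intro set_eqI) simp
qed

lemma distinct_concat_map:
  assumes "distinct ys" "\<And>y. distinct (f y)" "\<And>y y'. y \<noteq> y' \<Longrightarrow> set (f y) \<inter> set (f y') = {}"
  shows "distinct (concat (map f ys))"
  using assms(1)
proof (induction ys)
  case (Cons a ys)
  have "set (f a) \<inter> set (f y) = {}" if "y \<in> set ys" for y
    using Cons.prems that by (intro assms(3)) auto
  then show ?case using Cons assms(2) by auto
qed simp

lemma distinct_completions: "distinct (completions k S)"
proof (induction k arbitrary: S)
  case (Suc k)
  show ?case unfolding completions.simps
    by (rule distinct_concat_map) (auto simp: distinct_map Suc)
qed simp

definition enumeration :: "nat \<Rightarrow> nat list list" where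
  "enumeration n = completions n (replicate n False)"

lemma set_enumeration: "set (enumeration n) = orders n"
proof -
  have F: "{i. i < length (replicate n False) \<and> \<not> replicate n False ! i} = {..<n}"
    and U: "{i. i < length (replicate n False) \<and> replicate n False ! i} = {}" by auto
  show ?thesis
    using set_completions[of n "replicate n False"]
    unfolding F U enumeration_def orders_def by (simp add: ap_free_after_def)
qed

lemma sum_orders: "(\<Sum>X\<in>orders n. f X) = sum_list (map f (enumeration n))"
  unfolding set_enumeration[symmetric] enumeration_def
  by (rule sum.distinct_set_conv_list[OF distinct_completions])

text \<open>
  A sum over all orders of a given length is evaluated once, grouped by a key, in an association
  list. Weights are integers because evaluation by rewriting treats natural numbers in unary.
\<close>

fun add_weight :: "'a \<Rightarrow> int \<Rightarrow> ('a \<times> int) list \<Rightarrow> ('a \<times> int) list" where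
  "add_weight t w [] = [(t, w)]"
| "add_weight t w ((u, x) # l) = (if t = u then (u, x + w) # l else (u, x) # add_weight t w l)"

definition tally :: "('b \<Rightarrow> 'a) \<Rightarrow> ('b \<Rightarrow> int) \<Rightarrow> 'b list \<Rightarrow> ('a \<times> int) list" where
  "tally f w xs = foldr (\<lambda>X. add_weight (f X) (w X)) xs []"

lemma sum_add_weight:
  "(\<Sum>(u, x)\<leftarrow>add_weight t w l. x * h u) = w * h t + (\<Sum>(u, x)\<leftarrow>l. x * h u)"
  by (induction t w l rule: add_weight.induct) (auto simp: algebra_simps)

lemma sum_tally: "(\<Sum>(u, x)\<leftarrow>tally f w xs. x * h u) = (\<Sum>X\<leftarrow>xs. w X * h (f X))"
  by (induction xs) (simp_all add: tally_def sum_add_weight)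

lemma keys_tally: "fst ` set (tally f w xs) = f ` set xs"
proof -
  have "fst ` set (add_weight t w l) = insert t (fst ` set l)" for t :: 'a and w l
    by (induction t w l rule: add_weight.induct) auto
  then show ?thesis by (induction xs) (simp_all add: tally_def)
qed

lemma tally_first_8:
  "tally hd (\<lambda>_. 1) (enumeration 8) =
    [(7, 28), (6, 26), (5, 36), (4, 51), (3, 51), (2, 36), (1, 26), (0, 28)]"
  by code_simp

lemma tally_end_types_10:
  "tally end_type (\<lambda>X. int (end_weight (end_type (rev X)))) (enumeration 10) =
    [((9, 1), 509), ((8, 1), 509), ((7, 2), 226), ((7, 1), 1159), ((6, 3), 20), ((6, 2), 246),
     ((6, 1), 1159), ((5, 4), 20), ((5, 3), 226), ((5, 2), 509), ((5, 1), 877), ((4, 1), 877),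
     ((4, 2), 509), ((4, 3), 226), ((4, 4), 20), ((3, 1), 1159), ((3, 2), 246), ((3, 3), 20),
     ((2, 1), 1159), ((2, 2), 226), ((1, 1), 509), ((0, 1), 509)]"
  by code_simp

lemma lessThan_8: "{..<8::nat} = {0, 1, 2, 3, 4, 5, 6, 7}"
  by auto

lemma card_orders_hd_8:
  assumes "y < 8"
  shows "card {X \<in> orders 8. hd X = y} = [28, 26, 36, 51, 51, 36, 26, 28] ! y"
proof -
  have "int (card {X \<in> orders 8. hd X = y}) = (\<Sum>X\<in>orders 8. of_bool (hd X = y))"
    by (simp add: finite_orders sum_of_bool_eq Int_def)
  also have "\<dots> = (\<Sum>(u, x)\<leftarrow>tally hd (\<lambda>_. 1) (enumeration 8). x * of_bool (u = y))"
    unfolding sum_tally sum_orders by simp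
  also have "\<dots> = int ([28, 26, 36, 51, 51, 36, 26, 28] ! y)"
    using assms unfolding tally_first_8 lessThan_iff[symmetric] lessThan_8
    by (elim insertE emptyE) simp_all
  finally show ?thesis by simp
qed

lemma card_orders_8: "card (orders 8) = 282"
proof -
  have "int (card (orders 8)) = (\<Sum>X\<in>orders 8. 1)" by simp
  also have "\<dots> = (\<Sum>(u, x)\<leftarrow>tally hd (\<lambda>_. 1) (enumeration 8). x * 1)"
    unfolding sum_tally sum_orders by simp
  also have "\<dots> = 282" unfolding tally_first_8 by simp
  finally show ?thesis by simp
qed

lemma coarse_1: "coarse 1 X = X"
  by (simp add: coarse_def)

lemma short_ends_1: "short_ends 1"
proof -
  have "end_type X \<in> set end_types" if "X \<in> orders 10" for X
  proof -
    have "end_type X \<in> fst ` set (tally end_type (\<lambda>X. int (end_weight (end_type (rev X)))) (enumeration 10))"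
      unfolding keys_tally set_enumeration using that by blast
    then show ?thesis unfolding tally_end_types_10 end_types_def by auto
  qed
  then show ?thesis unfolding short_ends_def coarse_1 mult_1_right by (simp add: rev_orders)
qed

text \<open>
  The certificate for the spectral bound: with \<open>end_weight\<close> as test vector, the largest quotient is
  below \<open>3098\<close>. The rounded bound \<open>3100\<close> still satisfies \<open>3100\<^sup>8 < 399744\<^sup>5\<close>.
\<close>

lemma boundary_sum_1:
  assumes "s \<in> set end_types"
  shows "2 * boundary_sum 1 s \<le> 3100 * end_weight s"
proof -
  define T where "T = tally end_type (\<lambda>X. int (end_weight (end_type (rev X)))) (enumeration 10)"
  have "int (boundary_sum 1 s) =
      (\<Sum>X\<in>orders 10. int (end_weight (end_type (rev X))) * int (merge_bound s (end_type X)))"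
    unfolding boundary_sum_def coarse_1 by (simp add: mult.commute)
  also have "\<dots> = (\<Sum>(u, x)\<leftarrow>T. x * int (merge_bound s u))"
    unfolding T_def sum_tally sum_orders ..
  finally have "int (boundary_sum 1 s) = (\<Sum>(u, x)\<leftarrow>T. x * int (merge_bound s u))" .
  moreover have "\<forall>s\<in>set end_types. 2 * (\<Sum>(u, x)\<leftarrow>T. x * int (merge_bound s u)) \<le> 3100 * int (end_weight s)"
    unfolding T_def tally_end_types_10 by code_simp
  ultimately have "int (2 * boundary_sum 1 s) \<le> int (3100 * end_weight s)"
    using assms by simp
  then show ?thesis by (simp only: of_nat_le_iff)
qed

text \<open>
  Of the \<open>282\<^sup>2\<close> pairs of orders on eight elements, \<open>20412\<close> admit the exchange, for either
  choice of the leading class, and \<open>2 (282\<^sup>2 + 20412) = 199872\<close>.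
\<close>

lemma card_orders_16: "199872 \<le> card (orders 16)"
proof -
  have "card {(A, B) \<in> orders 8 \<times> orders 8. extremal 16 (2 * last A + \<delta>) (2 * hd B + (1 - \<delta>))} = 20412"
    if "\<delta> \<in> {0, 1}" for \<delta>
  proof -
    have "(\<Sum>l<8. \<Sum>f<8. [28, 26, 36, 51, 51, 36, 26, 28] ! l * [28, 26, 36, 51, 51, 36, 26, 28] ! f *
        of_bool (extremal 16 (2 * l + \<delta>) (2 * f + (1 - \<delta>)))) = (20412 :: nat)"
      using that unfolding lessThan_8 by (elim insertE emptyE) (simp_all add: extremal_def)
    moreover have "(\<Sum>l<8. \<Sum>f<8. card {X \<in> orders 8. hd X = l} * card {X \<in> orders 8. hd X = f} *
        of_bool (extremal 16 (2 * l + \<delta>) (2 * f + (1 - \<delta>)))) =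
      (\<Sum>l<8. \<Sum>f<8. [28, 26, 36, 51, 51, 36, 26, 28] ! l * [28, 26, 36, 51, 51, 36, 26, 28] ! f *
        of_bool (extremal 16 (2 * l + \<delta>) (2 * f + (1 - \<delta>))))"
      by (intro sum.cong refl) (simp only: card_orders_hd_8 lessThan_iff)
    moreover note card_pairs_by_ends[of 8 "\<lambda>l f. extremal 16 (2 * l + \<delta>) (2 * f + (1 - \<delta>))"]
    ultimately show ?thesis by (simp only: zero_less_numeral simp_thms)
  qed
  then show ?thesis
    using card_orders_double_ge[of 8] by (simp add: card_orders_8)
qed

section \<open>Two subsequences with different limits\<close>

text \<open>
  Constant factors disappear in the limit, so only the base of the double exponential counts.
\<close>

lemma root_of_double_power_tendsto:
  fixes c b :: real and m :: nat
  assumes "0 < c" "0 < b" "0 < m"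
  shows "(\<lambda>k. (c * b ^ 2 ^ k) powr (1 / real (m * 2 ^ k))) \<longlonglongrightarrow> b powr (1 / real m)"
proof -
  have "(\<lambda>k. (1 / real m) * (1 / 2) ^ k) \<longlonglongrightarrow> (1 / real m) * 0"
    by (intro tendsto_intros LIMSEQ_power_zero) simp
  then have "(\<lambda>k. 1 / real (m * 2 ^ k)) \<longlonglongrightarrow> 0" by (simp add: power_one_over field_simps)
  then have "(\<lambda>k. c powr (1 / real (m * 2 ^ k)) * b powr (1 / real m)) \<longlonglongrightarrow> c powr 0 * b powr (1 / real m)"
    using assms by (intro tendsto_intros) auto
  moreover have "(c * b ^ 2 ^ k) powr (1 / real (m * 2 ^ k)) = c powr (1 / real (m * 2 ^ k)) * b powr (1 / real m)" for k
  proof -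
    have "b ^ 2 ^ k = b powr real (2 ^ k)" using assms by (simp only: powr_realpow)
    then have "(b ^ 2 ^ k) powr (1 / real (m * 2 ^ k)) = b powr (1 / real m)"
      by (simp add: powr_powr)
    then show ?thesis using assms by (simp add: powr_mult)
  qed
  ultimately show ?thesis using assms by simp
qed

lemma strict_mono_mult_power: "0 < m \<Longrightarrow> strict_mono (\<lambda>k. m * 2 ^ k :: nat)"
  by (rule strict_monoI) simp

theorem theorem1:
  shows "\<not> convergent (\<lambda>n::nat. real (theta n) powr (1 / real n))"
proof
  define a where "a = (\<lambda>n::nat. real (theta n) powr (1 / real n))"
  assume "convergent (\<lambda>n::nat. real (theta n) powr (1 / real n))"
  then obtain L where L: "a \<longlonglongrightarrow> L" unfolding a_def convergent_def by blast
  have sub: "(\<lambda>k. a (m * 2 ^ k)) \<longlonglongrightarrow> L" if "0 < m" for m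
    using LIMSEQ_subseq_LIMSEQ[OF L strict_mono_mult_power[OF that]] by (simp add: o_def)
  have "L \<le> 3100 powr (1 / real 10)"
  proof (rule LIMSEQ_le[OF sub root_of_double_power_tendsto])
    have "a (10 * 2 ^ k) \<le> (12 * 3100 ^ 2 ^ k) powr (1 / real (10 * 2 ^ k))" for k
    proof -
      have "real (theta (10 * 2 ^ k)) \<le> real (12 * 3100 ^ 2 ^ k)"
        unfolding theta_eq_card_orders
        using card_orders_le[OF short_ends_1 boundary_sum_1] by (rule of_nat_mono)
      then show ?thesis unfolding a_def by (intro powr_mono2) simp_all
    qed
    then show "\<exists>N. \<forall>k\<ge>N. a (10 * 2 ^ k) \<le> (12 * 3100 ^ 2 ^ k) powr (1 / real (10 * 2 ^ k))" by blast
  qed simp_all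
  moreover have "399744 powr (1 / real 16) \<le> L"
  proof (rule LIMSEQ_le[OF root_of_double_power_tendsto sub])
    have "(1 / 2 * 399744 ^ 2 ^ k) powr (1 / real (16 * 2 ^ k)) \<le> a (16 * 2 ^ k)" for k
    proof -
      have "real (399744 ^ 2 ^ k) \<le> real (2 * theta (16 * 2 ^ k))"
        unfolding theta_eq_card_orders
        by (rule of_nat_mono, rule card_orders_power_ge) (use card_orders_16 in simp_all)
      then show ?thesis unfolding a_def by (intro powr_mono2) simp_all
    qed
    then show "\<exists>N. \<forall>k\<ge>N. (1 / 2 * 399744 ^ 2 ^ k) powr (1 / real (16 * 2 ^ k)) \<le> a (16 * 2 ^ k)" by blast
  qed simp_all
  moreover have "(3100 :: real) powr (1 / real 10) < 399744 powr (1 / real 16)"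
  proof -
    have pow: "(x ^ n) powr y = x powr (real n * y)" if "0 < x" for x y :: real and n
      using that by (simp add: powr_powr flip: powr_realpow)
    \<comment> \<open>\<open>80\<close> is the least common multiple of \<open>10\<close> and \<open>16\<close>.\<close>
    have "(3100 :: real) powr (1 / real 10) = (3100 ^ 8) powr (1 / 80)" by (subst pow) simp_all
    also have "\<dots> < (399744 ^ 5) powr (1 / 80)" by (rule powr_less_mono2) simp_all
    also have "\<dots> = 399744 powr (1 / real 16)" by (subst pow) simp_all
    finally show ?thesis .
  qed
  ultimately show False by linarith
qed

end
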